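(* Consider the single-stage signaling game described in the context. (i) If the encoder is affine, the optimal decoder is also affine. (ii) If the decoder is affine, the optimal encoder is also affine. (iii) For $\theta<\dfrac{\sigma_{\bf x}^2/\sigma_{\bf v}^2}{\left(\frac{\sigma_{\bf x}^2}{\sigma_{\bf w}^2}+1\right)^2}$, there are two affine Nash equilibria. In particular, letting $A^*\triangleq\sqrt{\sqrt{\frac1\theta\frac{\sigma_{\bf v}^2}{\sigma_{\bf x}^2}}-\frac{\sigma_{\bf v}^2}{\sigma_{\bf w}^2}-\frac{\sigma_{\bf v}^2}{\sigma_{\bf x}^2}}$, the two sets of $\gamma^e({\bf x})=A{\bf x}+C$, $\gamma^d({\bf r})=K{\bf r}+L$ and channel combining parameter $\alpha$ are characterized as: (a) $A=A^*$, $\ C=-\dfrac{\alpha Kb}{\theta}$, $\ K=\sqrt{\theta\dfrac{\sigma_{\bf x}^2}{\sigma_{\bf v}^2}}\left(A^*\sigma_{\bf x}^2\sigma_{\bf w}^2+\sigma_{\bf x}^2\sigma_{\bf v}^2\right)$, $\ L=\dfrac{\alpha^2K^2b}{\theta}$, $\ \alpha=\dfrac{A^*\sigma_{\bf w}^2}{A^*\sigma_{\bf w}^2+\sigma_{\bf v}^2}$; (b) $A=-\sqrt{\sqrt{\dfrac{\sigma_{\bf v}^2}{\theta\sigma_{\bf x}^2}}-\dfrac{\sigma_{\bf v}^2}{\sigma_{\bf x}^2}}$, $\ C=-\dfrac{b}{\theta}\sqrt{\sqrt{\dfrac{\theta\sigma_{\bf x}^2}{\sigma_{\bf v}^2}}-\theta}$,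 $\ K=\sqrt{\sqrt{\dfrac{\theta\sigma_{\bf x}^2}{\sigma_{\bf v}^2}}-\theta}$, $\ L=\dfrac{b}{\theta}\left(\sqrt{\dfrac{\theta\sigma_{\bf x}^2}{\sigma_{\bf v}^2}}-\theta\right)$, $\ \alpha=1$. Furthermore, for any value of $\theta$, the following also forms an affine Nash equilibrium: $$A=0,\quad C=0,\quad K=\frac{\sigma_{\bf x}^2}{\sigma_{\bf x}^2+\sigma_{\bf w}^2},\quad L=0,\quad \alpha=0.$$
   Context: Setting: ${\bf x}\sim\mathcal N(0,\sigma_{\bf x}^2)$, ${\bf v}\sim\mathcal N(0,\sigma_{\bf v}^2)$, ${\bf w}\sim\mathcal N(0,\sigma_{\bf w}^2)$ are independent scalar Gaussian random variables with positive variances. The encoder observes ${\bf x}$ and sends ${\bf m}=\gamma^e({\bf x})$. The decoder's strategy consists of a channel combining parameter $\alpha\in[0,1]$ together with a function $\gamma^d$; it receives ${\bf r}=\alpha({\bf m}+{\bf v})+(1-\alpha)({\bf x}+{\bf w})$ and outputs $\hat{\bf x}=\gamma^d({\bf r})$. An affine encoder is $\gamma^e({\bf x})=A{\bf x}+C$ and an affine decoder is $\gamma^d({\bf r})=K{\bf r}+L$, with real constants $A,C,K,L$. Costs: the encoder minimizes $J^e={\bf E}[({\bf x}-\hat{\bf x}-b)^2+\theta(\gamma^e({\bf x}))^2]$ and the decoder minimizes $J^d={\bf E}[({\bf x}-\hat{\bf x})^2]$. Here $b$ is a bias known to both players and $\theta$ is the coefficient of the encoder's soft power constraint ($\theta=0$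 corresponds to no power constraint). "Optimal decoder" means a minimizer of $J^d$ over decoder strategies $(\alpha,\gamma^d)$ for the given encoder; "optimal encoder" means a minimizer of $J^e$ over encoder strategies for the given $(\alpha,\gamma^d)$. A Nash equilibrium is a pair of an encoder strategy and a decoder strategy (including $\alpha$) such that neither player can lower its own cost by unilaterally changing its strategy; it is affine if $\gamma^e$ and $\gamma^d$ are affine.
   Formalization: Corrected: in (a) K is divided by σ_x²σ_w²; in (b) the signs of K and C are flipped. θ≥0 throughout, θ>0 in (iii); optimal strategies are affine almost surely; in (ii), if θ=0 and αK=0, only existence of an affine optimum is claimed. *)

theory Defs
  imports "HOL-Probability.Probability"
begin

(* normal_density takes the standard deviation, so the variances are the squares of
   \<sigma>x, \<sigma>v, \<sigma>w. *)
locale gaussian_sources = prob_space M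
  for M :: "'a measure" +
  fixes x v w :: "'a \<Rightarrow> real" and \<sigma>x \<sigma>v \<sigma>w :: real
  assumes std_dev_pos: "0 < \<sigma>x" "0 < \<sigma>v" "0 < \<sigma>w"
    and source_normal: "distributed M lborel x (normal_density 0 \<sigma>x)"
    and channel_noise_normal: "distributed M lborel v (normal_density 0 \<sigma>v)"
    and side_noise_normal: "distributed M lborel w (normal_density 0 \<sigma>w)"
    and independent: "indep_vars (\<lambda>_. borel) (\<lambda>i. [x, v, w] ! i) {0..<3::nat}"

definition received ::
  "('a \<Rightarrow> real) \<Rightarrow> ('a \<Rightarrow> real) \<Rightarrow> ('a \<Rightarrow> real) \<Rightarrow> (real \<Rightarrow> real) \<Rightarrow> real \<Rightarrow> 'a \<Rightarrow> real"
  where "received x v w enc \<alpha> \<omega> = \<alpha> * (enc (x \<omega>) + v \<omega>) + (1 - \<alpha>) * (x \<omega> + w \<omega>)"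

(* The costs are extended nonnegative integrals: a strategy whose expected cost is infinite
   has cost \<infinity>, whereas the Bochner integral would give it cost 0.  For \<theta> \<ge> 0 the
   integrand of the encoder cost is nonnegative, so ennreal does not truncate it. *)
definition encoder_cost ::
  "'a measure \<Rightarrow> ('a \<Rightarrow> real) \<Rightarrow> ('a \<Rightarrow> real) \<Rightarrow> ('a \<Rightarrow> real) \<Rightarrow> real \<Rightarrow> real \<Rightarrow>
    (real \<Rightarrow> real) \<Rightarrow> real \<Rightarrow> (real \<Rightarrow> real) \<Rightarrow> ennreal"
  where "encoder_cost M x v w \<theta> b enc \<alpha> dec =
    (\<integral>\<^sup>+ \<omega>. ennreal ((x \<omega> - dec (received x v w enc \<alpha> \<omega>) - b)\<^sup>2 + \<theta> * (enc (x \<omega>))\<^sup>2) \<partial>M)"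

definition decoder_cost ::
  "'a measure \<Rightarrow> ('a \<Rightarrow> real) \<Rightarrow> ('a \<Rightarrow> real) \<Rightarrow> ('a \<Rightarrow> real) \<Rightarrow>
    (real \<Rightarrow> real) \<Rightarrow> real \<Rightarrow> (real \<Rightarrow> real) \<Rightarrow> ennreal"
  where "decoder_cost M x v w enc \<alpha> dec =
    (\<integral>\<^sup>+ \<omega>. ennreal ((x \<omega> - dec (received x v w enc \<alpha> \<omega>))\<^sup>2) \<partial>M)"

definition optimal_encoder ::
  "'a measure \<Rightarrow> ('a \<Rightarrow> real) \<Rightarrow> ('a \<Rightarrow> real) \<Rightarrow> ('a \<Rightarrow> real) \<Rightarrow> real \<Rightarrow> real \<Rightarrow>
    real \<Rightarrow> (real \<Rightarrow> real) \<Rightarrow> (real \<Rightarrow> real) \<Rightarrow> bool"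
  where "optimal_encoder M x v w \<theta> b \<alpha> dec enc \<longleftrightarrow>
    enc \<in> borel_measurable borel \<and>
    (\<forall>enc' \<in> borel_measurable borel.
       encoder_cost M x v w \<theta> b enc \<alpha> dec \<le> encoder_cost M x v w \<theta> b enc' \<alpha> dec)"

definition optimal_decoder ::
  "'a measure \<Rightarrow> ('a \<Rightarrow> real) \<Rightarrow> ('a \<Rightarrow> real) \<Rightarrow> ('a \<Rightarrow> real) \<Rightarrow>
    (real \<Rightarrow> real) \<Rightarrow> real \<Rightarrow> (real \<Rightarrow> real) \<Rightarrow> bool"
  where "optimal_decoder M x v w enc \<alpha> dec \<longleftrightarrow>
    \<alpha> \<in> {0..1} \<and> dec \<in> borel_measurable borel \<and>
    (\<forall>\<alpha>' \<in> {0..1}. \<forall>dec' \<in> borel_measurable borel.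
       decoder_cost M x v w enc \<alpha> dec \<le> decoder_cost M x v w enc \<alpha>' dec')"

definition nash_equilibrium ::
  "'a measure \<Rightarrow> ('a \<Rightarrow> real) \<Rightarrow> ('a \<Rightarrow> real) \<Rightarrow> ('a \<Rightarrow> real) \<Rightarrow> real \<Rightarrow> real \<Rightarrow>
    (real \<Rightarrow> real) \<Rightarrow> real \<Rightarrow> (real \<Rightarrow> real) \<Rightarrow> bool"
  where "nash_equilibrium M x v w \<theta> b enc \<alpha> dec \<longleftrightarrow>
    optimal_encoder M x v w \<theta> b \<alpha> dec enc \<and> optimal_decoder M x v w enc \<alpha> dec"

definition affine_fun :: "real \<Rightarrow> real \<Rightarrow> real \<Rightarrow> real"
  where "affine_fun A C t = A * t + C"

(* Affine equilibria are represented by their parameters (A, C, K, L, \<alpha>); an affine function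
   determines its two coefficients. *)
definition affine_equilibria ::
  "'a measure \<Rightarrow> ('a \<Rightarrow> real) \<Rightarrow> ('a \<Rightarrow> real) \<Rightarrow> ('a \<Rightarrow> real) \<Rightarrow> real \<Rightarrow> real \<Rightarrow>
    (real \<times> real \<times> real \<times> real \<times> real) set"
  where "affine_equilibria M x v w \<theta> b =
    {(A, C, K, L, \<alpha>). nash_equilibrium M x v w \<theta> b (affine_fun A C) \<alpha> (affine_fun K L)}"

end

theory Submission
  imports Defs
begin

text \<open>
Write \<open>g = \<alpha> A + 1 - \<alpha>\<close> for the gain from the source to the received signal of an affine
encoder, and \<open>n = \<alpha> v + (1 - \<alpha>) w\<close> for the total noise, which is Gaussian with variance
\<open>N = \<alpha>\<^sup>2 \<sigma>v\<^sup>2 + (1 - \<alpha>)\<^sup>2 \<sigma>w\<^sup>2 > 0\<close> and independent of \<open>x\<close>. Both best responses reduce to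
completing a square, which turns each cost into a constant plus a nonnegative distance to one
affine strategy.

Decoder: up to the known shift \<open>\<alpha> C\<close>, the received signal is \<open>g x + n\<close>. Factoring the joint density
of \<open>(x, g x + n)\<close> into the marginal of the second component and a Gaussian posterior of the
first, whose mean is linear in the observation and whose variance is constant
(\<open>normal_density_bayes\<close>, \<open>estimation_error_decomposition\<close>), splits the cost of every measurable
decoder into the posterior variance, which depends on \<open>\<alpha>\<close> only, and the mean square
distance to the affine posterior mean. So a decoder is optimal iff \<open>\<alpha>\<close> minimises the posterior
variance and the decoder equals the posterior mean almost surely (\<open>optimal_decoder_iff\<close>).

Encoder: against an affine decoder the noise enters additively, so its contribution to the cost
does not depend on the encoder, and the rest is a quadratic in the single number \<open>enc (x \<omega>)\<close>
whose minimiser is affine in \<open>x \<omega>\<close> (\<open>optimal_encoder_iff\<close>).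

Combining parameter: the posterior variance decreases in \<open>g\<^sup>2 / N\<close>. For \<open>A \<ge> 0\<close> the Cauchy-Schwarz
inequality gives \<open>g\<^sup>2 / N \<le> A\<^sup>2 / \<sigma>v\<^sup>2 + 1 / \<sigma>w\<^sup>2\<close> with equality at exactly one \<open>\<alpha>\<close>
(\<open>optimal_weight_nonneg\<close>). For \<open>A < 0\<close> the two branches cancel each other, so only the better of
them should be used and \<open>\<alpha>\<close> is \<open>0\<close> or \<open>1\<close> (\<open>optimal_weight_neg\<close>).

Equilibria: for \<open>\<theta> > 0\<close> the stationarity conditions determine \<open>C\<close>, \<open>K\<close> and \<open>L\<close> from \<open>A\<close> and \<open>\<alpha>\<close>.
What remains is one equation for \<open>A\<close>. If \<open>A = 0\<close>, then \<open>\<alpha> = 0\<close> and the equilibrium is the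
uninformative one. If \<open>A > 0\<close> or \<open>A < 0\<close>, a common factor \<open>A\<close> cancels and the equation fixes \<open>A\<^sup>2\<close>; the
sign selects the root. The bound on \<open>\<theta>\<close> says precisely
\<open>\<surd>(\<sigma>v\<^sup>2 / (\<theta> \<sigma>x\<^sup>2)) > \<sigma>v\<^sup>2 / \<sigma>w\<^sup>2 + \<sigma>v\<^sup>2 / \<sigma>x\<^sup>2\<close>. It makes the first root real and positive, and
makes the direct channel the better branch at the second, negative one, where \<open>\<alpha> = 1\<close>.
\<close>

section \<open>Gaussian conditioning\<close>

lemma nn_integral_normal_density_square:
  assumes "0 < \<sigma>" "0 \<le> d"
  shows "(\<integral>\<^sup>+ y. ennreal (normal_density \<mu> \<sigma> y) * ennreal ((a * y + c)\<^sup>2 + d) \<partial>lborel) =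
    ennreal (a\<^sup>2 * \<sigma>\<^sup>2 + (a * \<mu> + c)\<^sup>2 + d)"
proof -
  have m0: "has_bochner_integral lborel (normal_density \<mu> \<sigma>) 1"
    using integral_normal_density[OF assms(1)] integrable_normal_density[OF assms(1)]
    by (simp add: has_bochner_integral_iff)
  have m1: "has_bochner_integral lborel (\<lambda>y. normal_density \<mu> \<sigma> y * (y - \<mu>)) 0"
    using normal_moment_odd[OF assms(1), of \<mu> 0] by simp
  have m2: "has_bochner_integral lborel (\<lambda>y. normal_density \<mu> \<sigma> y * (y - \<mu>)\<^sup>2) (\<sigma>\<^sup>2)"
    using normal_moment_even[OF assms(1), of \<mu> 1] by (simp add: fact_numeral)
  have "has_bochner_integral lborel
      (\<lambda>y. a\<^sup>2 * (normal_density \<mu> \<sigma> y * (y - \<mu>)\<^sup>2)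
         + 2 * a * (a * \<mu> + c) * (normal_density \<mu> \<sigma> y * (y - \<mu>))
         + ((a * \<mu> + c)\<^sup>2 + d) * normal_density \<mu> \<sigma> y)
      (a\<^sup>2 * \<sigma>\<^sup>2 + 2 * a * (a * \<mu> + c) * 0 + ((a * \<mu> + c)\<^sup>2 + d) * 1)"
    by (intro has_bochner_integral_add has_bochner_integral_mult_right m0 m1 m2)
  also have "(\<lambda>y. a\<^sup>2 * (normal_density \<mu> \<sigma> y * (y - \<mu>)\<^sup>2)
         + 2 * a * (a * \<mu> + c) * (normal_density \<mu> \<sigma> y * (y - \<mu>))
         + ((a * \<mu> + c)\<^sup>2 + d) * normal_density \<mu> \<sigma> y) =
      (\<lambda>y. normal_density \<mu> \<sigma> y * ((a * y + c)\<^sup>2 + d))"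
    by (rule ext) (simp add: power2_eq_square algebra_simps)
  finally have "has_bochner_integral lborel
      (\<lambda>y. normal_density \<mu> \<sigma> y * ((a * y + c)\<^sup>2 + d)) (a\<^sup>2 * \<sigma>\<^sup>2 + (a * \<mu> + c)\<^sup>2 + d)"
    by (simp add: add.assoc)
  then have "(\<integral>\<^sup>+ y. ennreal (normal_density \<mu> \<sigma> y * ((a * y + c)\<^sup>2 + d)) \<partial>lborel) =
      ennreal (a\<^sup>2 * \<sigma>\<^sup>2 + (a * \<mu> + c)\<^sup>2 + d)"
    using assms by (subst nn_integral_eq_integral)
      (auto simp: has_bochner_integral_iff normal_density_nonneg)
  then show ?thesis
    using assms by (simp add: ennreal_mult normal_density_nonneg)
qed

text \<open>Bayes' rule for a Gaussian prior and a Gaussian likelihood: with prior \<open>N(0, \<sigma>\<^sup>2)\<close> for \<open>a\<close> and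
observation \<open>r = g a + noise\<close>, the joint density is also the marginal density of \<open>r\<close>, of
variance \<open>R\<close>, times the posterior density of \<open>a\<close>. Comparing exponents is completing the square in \<open>a\<close>.\<close>

lemma normal_density_bayes:
  fixes \<sigma> \<tau> g a r :: real
  assumes "0 < \<sigma>" "0 < \<tau>"
  defines "R \<equiv> g\<^sup>2 * \<sigma>\<^sup>2 + \<tau>\<^sup>2"
  shows "normal_density 0 \<sigma> a * normal_density 0 \<tau> (r - g * a) =
    normal_density 0 (sqrt R) r * normal_density (g * \<sigma>\<^sup>2 / R * r) (\<sigma> * \<tau> / sqrt R) a"
proof -
  have R: "0 < R" unfolding R_def using assms by (simp add: add_nonneg_pos)
  have sq: "(sqrt R)\<^sup>2 = R" using R by simp
  have ex: "a\<^sup>2 / (2 * \<sigma>\<^sup>2) + (r - g * a)\<^sup>2 / (2 * \<tau>\<^sup>2) =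
      r\<^sup>2 / (2 * R) + (a - g * \<sigma>\<^sup>2 / R * r)\<^sup>2 / (2 * (\<sigma> * \<tau> / sqrt R)\<^sup>2)"
  proof -
    have "(a - g * \<sigma>\<^sup>2 / R * r)\<^sup>2 / (2 * (\<sigma> * \<tau> / sqrt R)\<^sup>2) = (R * a - g * \<sigma>\<^sup>2 * r)\<^sup>2 / (2 * R * \<sigma>\<^sup>2 * \<tau>\<^sup>2)"
    proof -
      have "a - g * \<sigma>\<^sup>2 / R * r = (R * a - g * \<sigma>\<^sup>2 * r) / R"
        using R by (simp add: field_simps)
      then show ?thesis
        using R assms(1,2) sq by (simp add: power_divide power_mult_distrib) (simp add: field_simps power2_eq_square)
    qed
    moreover have "a\<^sup>2 / (2 * \<sigma>\<^sup>2) + (r - g * a)\<^sup>2 / (2 * \<tau>\<^sup>2) - r\<^sup>2 / (2 * R) =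
       (R * a - g * \<sigma>\<^sup>2 * r)\<^sup>2 / (2 * R * \<sigma>\<^sup>2 * \<tau>\<^sup>2)"
    proof -
      have "a\<^sup>2 / (2 * \<sigma>\<^sup>2) + (r - g * a)\<^sup>2 / (2 * \<tau>\<^sup>2) - r\<^sup>2 / (2 * R) =
          (a\<^sup>2 * \<tau>\<^sup>2 * R + (r - g * a)\<^sup>2 * \<sigma>\<^sup>2 * R - r\<^sup>2 * \<sigma>\<^sup>2 * \<tau>\<^sup>2) / (2 * R * \<sigma>\<^sup>2 * \<tau>\<^sup>2)"
        using R assms(1,2) by (simp add: field_simps)
      also have "a\<^sup>2 * \<tau>\<^sup>2 * R + (r - g * a)\<^sup>2 * \<sigma>\<^sup>2 * R - r\<^sup>2 * \<sigma>\<^sup>2 * \<tau>\<^sup>2 = (R * a - g * \<sigma>\<^sup>2 * r)\<^sup>2"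
        unfolding R_def by algebra
      finally show ?thesis .
    qed
    ultimately show ?thesis by simp
  qed
  have "normal_density 0 \<sigma> a * normal_density 0 \<tau> (r - g * a) =
     1 / (sqrt (2 * pi * \<sigma>\<^sup>2) * sqrt (2 * pi * \<tau>\<^sup>2)) *
       exp (- (a\<^sup>2 / (2 * \<sigma>\<^sup>2) + (r - g * a)\<^sup>2 / (2 * \<tau>\<^sup>2)))"
    unfolding normal_density_def by (simp add: exp_minus exp_add exp_diff)  (simp add: field_simps)
  also have "sqrt (2 * pi * \<sigma>\<^sup>2) * sqrt (2 * pi * \<tau>\<^sup>2) =
      sqrt (2 * pi * (sqrt R)\<^sup>2) * sqrt (2 * pi * (\<sigma> * \<tau> / sqrt R)\<^sup>2)"
    using R sq by (simp add: real_sqrt_mult[symmetric] power_divide power_mult_distrib) 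
  also have "1 / (sqrt (2 * pi * (sqrt R)\<^sup>2) * sqrt (2 * pi * (\<sigma> * \<tau> / sqrt R)\<^sup>2)) *
       exp (- (a\<^sup>2 / (2 * \<sigma>\<^sup>2) + (r - g * a)\<^sup>2 / (2 * \<tau>\<^sup>2))) =
     normal_density 0 (sqrt R) r * normal_density (g * \<sigma>\<^sup>2 / R * r) (\<sigma> * \<tau> / sqrt R) a"
    unfolding normal_density_def ex sq by (simp add: exp_minus exp_add exp_diff)  (simp add: field_simps)
  finally show ?thesis .
qed

context prob_space
begin

lemma nn_integral_indep_normal:
  assumes "0 < \<sigma>" "0 < \<tau>"
    and X: "distributed M lborel X (normal_density 0 \<sigma>)"
    and Y: "distributed M lborel Y (normal_density 0 \<tau>)"
    and indep: "indep_var borel X borel Y"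
    and [measurable]: "case_prod F \<in> borel_measurable (borel \<Otimes>\<^sub>M borel)"
  shows "(\<integral>\<^sup>+ \<omega>. F (X \<omega>) (Y \<omega>) \<partial>M) =
    (\<integral>\<^sup>+ a. ennreal (normal_density 0 \<sigma> a) *
       (\<integral>\<^sup>+ y. ennreal (normal_density 0 \<tau> y) * F a y \<partial>lborel) \<partial>lborel)"
proof -
  have i: "indep_var lborel X lborel Y"
    using indep_var_compose[OF indep, of id lborel id lborel] by simp
  have "distributed M (lborel \<Otimes>\<^sub>M lborel) (\<lambda>\<omega>. (X \<omega>, Y \<omega>))
     (\<lambda>(a, y). ennreal (normal_density 0 \<sigma> a) * ennreal (normal_density 0 \<tau> y))"
    by (rule distributed_joint_indep[OF _ _ X Y i]) (rule lborel.sigma_finite_measure_axioms)+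
  from distributed_nn_integral[OF this, of "case_prod F"]
  have "(\<integral>\<^sup>+ \<omega>. F (X \<omega>) (Y \<omega>) \<partial>M) =
     (\<integral>\<^sup>+ z. (case z of (a, y) \<Rightarrow> ennreal (normal_density 0 \<sigma> a) * ennreal (normal_density 0 \<tau> y)) *
        case_prod F z \<partial>(lborel \<Otimes>\<^sub>M lborel))"
    by simp
  also have "\<dots> = (\<integral>\<^sup>+ a. \<integral>\<^sup>+ y. ennreal (normal_density 0 \<sigma> a) * ennreal (normal_density 0 \<tau> y) * F a y
       \<partial>lborel \<partial>lborel)"
    by (subst lborel.nn_integral_fst[symmetric]) simp_all
  also have "\<dots> = (\<integral>\<^sup>+ a. ennreal (normal_density 0 \<sigma> a) *
       (\<integral>\<^sup>+ y. ennreal (normal_density 0 \<tau> y) * F a y \<partial>lborel) \<partial>lborel)"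
    by (simp add: mult.assoc nn_integral_cmult)
  finally show ?thesis .
qed

text \<open>Disintegration of the joint law of a source and its noisy observation along the
observation. The statement is in terms of nonnegative integrals, so that decoders of infinite cost
need no separate treatment.\<close>

lemma nn_integral_posterior:
  fixes g :: real
  assumes "0 < \<sigma>" "0 < \<tau>"
    and X: "distributed M lborel X (normal_density 0 \<sigma>)"
    and Y: "distributed M lborel Y (normal_density 0 \<tau>)"
    and indep: "indep_var borel X borel Y"
    and [measurable]: "case_prod F \<in> borel_measurable (borel \<Otimes>\<^sub>M borel)"
  defines "R \<equiv> g\<^sup>2 * \<sigma>\<^sup>2 + \<tau>\<^sup>2"
  shows "(\<integral>\<^sup>+ \<omega>. F (X \<omega>) (g * X \<omega> + Y \<omega>) \<partial>M) =
    (\<integral>\<^sup>+ r. ennreal (normal_density 0 (sqrt R) r) *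
       (\<integral>\<^sup>+ a. ennreal (normal_density (g * \<sigma>\<^sup>2 / R * r) (\<sigma> * \<tau> / sqrt R) a) * F a r \<partial>lborel) \<partial>lborel)"
proof -
  have "(\<integral>\<^sup>+ \<omega>. F (X \<omega>) (g * X \<omega> + Y \<omega>) \<partial>M) =
    (\<integral>\<^sup>+ a. ennreal (normal_density 0 \<sigma> a) *
       (\<integral>\<^sup>+ y. ennreal (normal_density 0 \<tau> y) * F a (g * a + y) \<partial>lborel) \<partial>lborel)"
    by (rule nn_integral_indep_normal[OF assms(1-5), of "\<lambda>a y. F a (g * a + y)"]) measurable
  also have "\<dots> = (\<integral>\<^sup>+ a. ennreal (normal_density 0 \<sigma> a) *
       (\<integral>\<^sup>+ r. ennreal (normal_density 0 \<tau> (r - g * a)) * F a r \<partial>lborel) \<partial>lborel)"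
  proof (rule nn_integral_cong)
    fix a :: real
    have "(\<integral>\<^sup>+ r. ennreal (normal_density 0 \<tau> (r - g * a)) * F a r \<partial>lborel) =
      (\<integral>\<^sup>+ y. ennreal (normal_density 0 \<tau> y) * F a (g * a + y) \<partial>lborel)"
      using nn_integral_real_affine[of "\<lambda>r. ennreal (normal_density 0 \<tau> (r - g * a)) * F a r" 1 "g * a"]
      by simp
    then show "ennreal (normal_density 0 \<sigma> a) *
        (\<integral>\<^sup>+ y. ennreal (normal_density 0 \<tau> y) * F a (g * a + y) \<partial>lborel) =
      ennreal (normal_density 0 \<sigma> a) *
       (\<integral>\<^sup>+ r. ennreal (normal_density 0 \<tau> (r - g * a)) * F a r \<partial>lborel)"
      by simp
  qed
  also have "\<dots> = (\<integral>\<^sup>+ a. \<integral>\<^sup>+ r. ennreal (normal_density 0 \<sigma> a) *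
       (ennreal (normal_density 0 \<tau> (r - g * a)) * F a r) \<partial>lborel \<partial>lborel)"
    by (simp add: nn_integral_cmult)
  also have "\<dots> = (\<integral>\<^sup>+ r. \<integral>\<^sup>+ a. ennreal (normal_density 0 \<sigma> a) *
       (ennreal (normal_density 0 \<tau> (r - g * a)) * F a r) \<partial>lborel \<partial>lborel)"
    by (rule lborel_pair.Fubini'[symmetric]) measurable
  also have "\<dots> = (\<integral>\<^sup>+ r. \<integral>\<^sup>+ a. ennreal (normal_density 0 (sqrt R) r) *
       (ennreal (normal_density (g * \<sigma>\<^sup>2 / R * r) (\<sigma> * \<tau> / sqrt R) a) * F a r) \<partial>lborel \<partial>lborel)"
    using normal_density_bayes[OF assms(1,2), of _ _ g, folded R_def]
    by (simp add: mult.assoc[symmetric] ennreal_mult'[symmetric] normal_density_nonneg)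
  also have "\<dots> = (\<integral>\<^sup>+ r. ennreal (normal_density 0 (sqrt R) r) *
       (\<integral>\<^sup>+ a. ennreal (normal_density (g * \<sigma>\<^sup>2 / R * r) (\<sigma> * \<tau> / sqrt R) a) * F a r \<partial>lborel) \<partial>lborel)"
    by (simp add: nn_integral_cmult)
  finally show ?thesis .
qed

text \<open>Nonzero noise makes the observation nondegenerate, so this second moment vanishes only if both
coefficients do; hence affine decoders that agree almost surely have the same coefficients.\<close>

lemma nn_integral_affine_observation:
  fixes g :: real
  assumes "0 < \<sigma>" "0 < \<tau>"
    and X: "distributed M lborel X (normal_density 0 \<sigma>)"
    and Y: "distributed M lborel Y (normal_density 0 \<tau>)"
    and indep: "indep_var borel X borel Y"
  shows "(\<integral>\<^sup>+ \<omega>. ennreal ((a * (g * X \<omega> + Y \<omega>) + c)\<^sup>2) \<partial>M) =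
    ennreal (a\<^sup>2 * (g\<^sup>2 * \<sigma>\<^sup>2 + \<tau>\<^sup>2) + c\<^sup>2)"
proof -
  have R: "0 < g\<^sup>2 * \<sigma>\<^sup>2 + \<tau>\<^sup>2" using assms by (simp add: add_nonneg_pos)
  have p: "(\<integral>\<^sup>+ z. ennreal (normal_density \<mu> \<rho> z) * e \<partial>lborel) = e" if "0 < \<rho>" for \<mu> \<rho> e
  proof -
    have "(\<integral>\<^sup>+ z. ennreal (normal_density \<mu> \<rho> z) \<partial>lborel) = 1"
      using nn_integral_normal_density_square[OF that, of 0 \<mu> 0 1] by simp
    then show ?thesis by (simp add: nn_integral_multc)
  qed
  have "(\<integral>\<^sup>+ \<omega>. ennreal ((a * (g * X \<omega> + Y \<omega>) + c)\<^sup>2) \<partial>M) =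
    (\<integral>\<^sup>+ r. ennreal (normal_density 0 (sqrt (g\<^sup>2 * \<sigma>\<^sup>2 + \<tau>\<^sup>2)) r) * ennreal ((a * r + c)\<^sup>2) \<partial>lborel)"
    using R assms(1,2)
    by (subst nn_integral_posterior[OF assms(1-5), of "\<lambda>_ r. ennreal ((a * r + c)\<^sup>2)"]) (simp_all add: p)
  also have "\<dots> = ennreal (a\<^sup>2 * (g\<^sup>2 * \<sigma>\<^sup>2 + \<tau>\<^sup>2) + c\<^sup>2)"
    using nn_integral_normal_density_square[of "sqrt (g\<^sup>2 * \<sigma>\<^sup>2 + \<tau>\<^sup>2)" 0 0 a c] R by simp
  finally show ?thesis .
qed

text \<open>Bias-variance decomposition under the posterior: for a fixed observation the mean of
\<open>(X - c)\<^sup>2\<close> is the posterior variance, here independent of the observation, plus the squared distance of \<open>c\<close>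
from the posterior mean.\<close>

lemma estimation_error_decomposition:
  fixes g :: real
  assumes "0 < \<sigma>" "0 < \<tau>"
    and X: "distributed M lborel X (normal_density 0 \<sigma>)"
    and Y: "distributed M lborel Y (normal_density 0 \<tau>)"
    and indep: "indep_var borel X borel Y"
    and [measurable]: "h \<in> borel_measurable borel"
  defines "R \<equiv> g\<^sup>2 * \<sigma>\<^sup>2 + \<tau>\<^sup>2"
  shows "(\<integral>\<^sup>+ \<omega>. ennreal ((X \<omega> - h (g * X \<omega> + Y \<omega>))\<^sup>2) \<partial>M) =
    ennreal (\<sigma>\<^sup>2 * \<tau>\<^sup>2 / R) +
    (\<integral>\<^sup>+ \<omega>. ennreal ((g * \<sigma>\<^sup>2 / R * (g * X \<omega> + Y \<omega>) - h (g * X \<omega> + Y \<omega>))\<^sup>2) \<partial>M)"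
proof -
  have [measurable]: "X \<in> borel_measurable M" "Y \<in> borel_measurable M"
    using distributed_measurable[OF X] distributed_measurable[OF Y] by simp_all
  have R: "0 < R" unfolding R_def using assms by (simp add: add_nonneg_pos)
  let ?D = "\<lambda>r. (g * \<sigma>\<^sup>2 / R * r - h r)\<^sup>2"
  have post: "0 < \<sigma> * \<tau> / sqrt R" "(\<sigma> * \<tau> / sqrt R)\<^sup>2 = \<sigma>\<^sup>2 * \<tau>\<^sup>2 / R"
    using R assms(1,2) by (simp_all add: power_divide power_mult_distrib)
  have sq: "(\<integral>\<^sup>+ a. ennreal (normal_density (g * \<sigma>\<^sup>2 / R * r) (\<sigma> * \<tau> / sqrt R) a) *
      ennreal ((a - h r)\<^sup>2) \<partial>lborel) = ennreal (\<sigma>\<^sup>2 * \<tau>\<^sup>2 / R + ?D r)" for r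
    using nn_integral_normal_density_square[OF post(1), of 0 "g * \<sigma>\<^sup>2 / R * r" 1 "- h r"] post(2) by simp
  have one: "(\<integral>\<^sup>+ a. ennreal (normal_density (g * \<sigma>\<^sup>2 / R * r) (\<sigma> * \<tau> / sqrt R) a) *
      ennreal (\<sigma>\<^sup>2 * \<tau>\<^sup>2 / R + ?D r) \<partial>lborel) = ennreal (\<sigma>\<^sup>2 * \<tau>\<^sup>2 / R + ?D r)" for r
    using nn_integral_normal_density_square[OF post(1), of "\<sigma>\<^sup>2 * \<tau>\<^sup>2 / R + ?D r" "g * \<sigma>\<^sup>2 / R * r" 0 0] R
    by simp
  have "(\<integral>\<^sup>+ \<omega>. ennreal ((X \<omega> - h (g * X \<omega> + Y \<omega>))\<^sup>2) \<partial>M) =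
    (\<integral>\<^sup>+ r. ennreal (normal_density 0 (sqrt R) r) * ennreal (\<sigma>\<^sup>2 * \<tau>\<^sup>2 / R + ?D r) \<partial>lborel)"
    by (subst nn_integral_posterior[OF assms(1-5), of "\<lambda>a r. ennreal ((a - h r)\<^sup>2)" g, folded R_def])
      (simp_all only: sq, measurable)
  also have "\<dots> = (\<integral>\<^sup>+ \<omega>. ennreal (\<sigma>\<^sup>2 * \<tau>\<^sup>2 / R + ?D (g * X \<omega> + Y \<omega>)) \<partial>M)"
    by (subst nn_integral_posterior[OF assms(1-5),
          of "\<lambda>a r. ennreal (\<sigma>\<^sup>2 * \<tau>\<^sup>2 / R + ?D r)" g, folded R_def])
      (simp_all only: one, measurable)
  also have "\<dots> = (\<integral>\<^sup>+ \<omega>. ennreal (\<sigma>\<^sup>2 * \<tau>\<^sup>2 / R) + ennreal (?D (g * X \<omega> + Y \<omega>)) \<partial>M)"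
    using R by (simp add: ennreal_plus)
  also have "\<dots> = ennreal (\<sigma>\<^sup>2 * \<tau>\<^sup>2 / R) + (\<integral>\<^sup>+ \<omega>. ennreal (?D (g * X \<omega> + Y \<omega>)) \<partial>M)"
    by (subst nn_integral_add) (simp_all add: emeasure_space_1)
  finally show ?thesis .
qed

end

section \<open>The received signal\<close>

context gaussian_sources
begin

definition gain :: "real \<Rightarrow> real \<Rightarrow> real"
  where "gain A \<alpha> = \<alpha> * A + (1 - \<alpha>)"

definition noise_var :: "real \<Rightarrow> real"
  where "noise_var \<alpha> = \<alpha>\<^sup>2 * \<sigma>v\<^sup>2 + (1 - \<alpha>)\<^sup>2 * \<sigma>w\<^sup>2"

definition received_var :: "real \<Rightarrow> real \<Rightarrow> real"
  where "received_var A \<alpha> = (gain A \<alpha>)\<^sup>2 * \<sigma>x\<^sup>2 + noise_var \<alpha>"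

text \<open>The posterior variance of the source given the received signal; \<open>wiener_gain\<close> below is the
slope of its posterior mean.\<close>

definition mmse :: "real \<Rightarrow> real \<Rightarrow> real"
  where "mmse A \<alpha> = \<sigma>x\<^sup>2 * noise_var \<alpha> / received_var A \<alpha>"

definition wiener_gain :: "real \<Rightarrow> real \<Rightarrow> real"
  where "wiener_gain A \<alpha> = gain A \<alpha> * \<sigma>x\<^sup>2 / received_var A \<alpha>"

lemma measurable_sources [measurable]:
  "x \<in> borel_measurable M" "v \<in> borel_measurable M" "w \<in> borel_measurable M"
  using distributed_measurable[OF source_normal] distributed_measurable[OF channel_noise_normal]
    distributed_measurable[OF side_noise_normal] by simp_all

lemma noise_var_pos: "0 < noise_var \<alpha>"
proof (cases "\<alpha> = 0")
  case True
  then show ?thesis using std_dev_pos by (simp add: noise_var_def)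
next
  case False
  then show ?thesis using std_dev_pos by (simp add: noise_var_def add_pos_nonneg)
qed

lemma received_var_pos: "0 < received_var A \<alpha>"
  using noise_var_pos by (simp add: received_var_def add_nonneg_pos)

lemma
  shows indep_source_noise: "indep_var borel x borel (\<lambda>\<omega>. \<alpha> * v \<omega> + (1 - \<alpha>) * w \<omega>)"
    and noise_normal: "distributed M lborel (\<lambda>\<omega>. \<alpha> * v \<omega> + (1 - \<alpha>) * w \<omega>)
      (normal_density 0 (sqrt (noise_var \<alpha>)))"
proof -
  define X where "X i = (\<lambda>\<omega>. [1, \<alpha>, 1 - \<alpha>] ! i * ([x, v, w] ! i) \<omega>)" for i :: nat
  have X: "X 0 = x" "X 1 = (\<lambda>\<omega>. \<alpha> * v \<omega>)" "X (Suc 0) = (\<lambda>\<omega>. \<alpha> * v \<omega>)"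
    "X 2 = (\<lambda>\<omega>. (1 - \<alpha>) * w \<omega>)"
    by (simp_all add: X_def)
  have "indep_vars (\<lambda>_. borel) X {0..<3}"
    unfolding X_def
    by (rule indep_vars_compose2[OF independent, of "\<lambda>i y. [1, \<alpha>, 1 - \<alpha>] ! i * y" "\<lambda>_. borel"]) simp
  then have ind: "indep_vars (\<lambda>_. borel) X (insert 0 {1, 2})"
    by (simp add: atLeast0_lessThan_Suc eval_nat_numeral insert_commute)
  from indep_vars_sum[OF _ _ this]
  show "indep_var borel x borel (\<lambda>\<omega>. \<alpha> * v \<omega> + (1 - \<alpha>) * w \<omega>)"
    by (simp add: X)
  have "indep_vars (\<lambda>_. borel) X (insert 1 {2})"
    by (rule indep_vars_subset[OF ind]) auto
  from indep_vars_sum[OF _ _ this]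
  have ind2: "indep_var borel (\<lambda>\<omega>. \<alpha> * v \<omega>) borel (\<lambda>\<omega>. (1 - \<alpha>) * w \<omega>)"
    by (simp add: X)
  \<comment> \<open>At the endpoints one summand is the constant 0, which has no density, so the sum rule for
    independent normal variables applies only in the interior.\<close>
  consider "\<alpha> = 0" | "\<alpha> = 1" | "\<alpha> \<noteq> 0" "1 - \<alpha> \<noteq> 0" by auto
  then show "distributed M lborel (\<lambda>\<omega>. \<alpha> * v \<omega> + (1 - \<alpha>) * w \<omega>)
      (normal_density 0 (sqrt (noise_var \<alpha>)))"
  proof cases
    case 1
    then show ?thesis using side_noise_normal std_dev_pos by (simp add: noise_var_def)
  next
    case 2
    then show ?thesis using channel_noise_normal std_dev_pos by (simp add: noise_var_def)
  next
    case 3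
    have "distributed M lborel (\<lambda>\<omega>. \<alpha> * v \<omega>) (normal_density 0 (\<bar>\<alpha>\<bar> * \<sigma>v))"
      using normal_density_affine[OF channel_noise_normal _ 3(1), of 0] std_dev_pos by simp
    moreover have "distributed M lborel (\<lambda>\<omega>. (1 - \<alpha>) * w \<omega>) (normal_density 0 (\<bar>1 - \<alpha>\<bar> * \<sigma>w))"
      using normal_density_affine[OF side_noise_normal _ 3(2), of 0] std_dev_pos by simp
    ultimately show ?thesis
      using add_indep_normal[OF ind2, of "\<bar>\<alpha>\<bar> * \<sigma>v" "\<bar>1 - \<alpha>\<bar> * \<sigma>w" 0 0] 3 std_dev_pos
      by (simp add: noise_var_def power_mult_distrib)
  qed
qed

lemma nn_integral_affine_source:
  "(\<integral>\<^sup>+ \<omega>. ennreal ((a * x \<omega> + c)\<^sup>2) \<partial>M) = ennreal (a\<^sup>2 * \<sigma>x\<^sup>2 + c\<^sup>2)"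
  using distributed_nn_integral[OF source_normal, of "\<lambda>z. ennreal ((a * z + c)\<^sup>2)"]
    nn_integral_normal_density_square[of \<sigma>x 0 0 a c] std_dev_pos by simp

lemma affine_source_AE_zero:
  assumes "AE \<omega> in M. a * x \<omega> + c = 0"
  shows "a = 0 \<and> c = 0"
proof -
  have "(\<integral>\<^sup>+ \<omega>. ennreal ((a * x \<omega> + c)\<^sup>2) \<partial>M) = 0"
    using assms by (subst nn_integral_0_iff_AE) auto
  then have "a\<^sup>2 * \<sigma>x\<^sup>2 + c\<^sup>2 \<le> 0"
    unfolding nn_integral_affine_source by (simp only: ennreal_eq_0_iff)
  moreover have "0 \<le> a\<^sup>2 * \<sigma>x\<^sup>2" "0 \<le> c\<^sup>2" by simp_all
  ultimately have "a\<^sup>2 * \<sigma>x\<^sup>2 = 0 \<and> c\<^sup>2 = 0" by linarith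
  then show ?thesis using std_dev_pos by simp
qed

section \<open>Best responses of the decoder\<close>

lemma received_affine:
  "received x v w (affine_fun A C) \<alpha> \<omega> =
    gain A \<alpha> * x \<omega> + (\<alpha> * v \<omega> + (1 - \<alpha>) * w \<omega>) + \<alpha> * C"
  by (simp add: received_def affine_fun_def gain_def algebra_simps)

definition bayes_decoder :: "real \<Rightarrow> real \<Rightarrow> real \<Rightarrow> real \<Rightarrow> real"
  where "bayes_decoder A C \<alpha> = affine_fun (wiener_gain A \<alpha>) (- (wiener_gain A \<alpha> * \<alpha> * C))"

lemma measurable_affine_fun [measurable]: "affine_fun A C \<in> borel_measurable borel"
  unfolding affine_fun_def[abs_def] by measurable

lemma measurable_bayes_decoder [measurable]: "bayes_decoder A C \<alpha> \<in> borel_measurable borel"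
  unfolding bayes_decoder_def by measurable

lemma measurable_received [measurable]:
  assumes [measurable]: "enc \<in> borel_measurable borel"
  shows "received x v w enc \<alpha> \<in> borel_measurable M"
  unfolding received_def[abs_def] by measurable

lemma affine_received_AE_zero:
  assumes "AE \<omega> in M. a * received x v w (affine_fun A C) \<alpha> \<omega> + c = 0"
  shows "a = 0 \<and> c = 0"
proof -
  have a: "AE \<omega> in M. a * (gain A \<alpha> * x \<omega> + (\<alpha> * v \<omega> + (1 - \<alpha>) * w \<omega>)) + (a * \<alpha> * C + c) = 0"
    using assms by (rule AE_mp) (simp add: received_affine algebra_simps)
  have "(\<integral>\<^sup>+ \<omega>. ennreal ((a * (gain A \<alpha> * x \<omega> + (\<alpha> * v \<omega> + (1 - \<alpha>) * w \<omega>)) + (a * \<alpha> * C + c))\<^sup>2) \<partial>M) = 0"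
    using a by (subst nn_integral_0_iff_AE) auto
  then have "a\<^sup>2 * received_var A \<alpha> + (a * \<alpha> * C + c)\<^sup>2 \<le> 0"
    using noise_var_pos[of \<alpha>]
    by (subst (asm) nn_integral_affine_observation[OF std_dev_pos(1) _ source_normal noise_normal indep_source_noise])
      (simp, simp only: ennreal_eq_0_iff received_var_def real_sqrt_pow2 less_imp_le)
  moreover have "0 \<le> a\<^sup>2 * received_var A \<alpha>" using received_var_pos[of A \<alpha>] by simp
  ultimately have "a\<^sup>2 * received_var A \<alpha> = 0 \<and> (a * \<alpha> * C + c)\<^sup>2 = 0"
    using zero_le_power2[of "a * \<alpha> * C + c"] by linarith
  then show ?thesis using received_var_pos[of A \<alpha>] by auto
qed

lemma bayes_decoder_shift: "bayes_decoder A C \<alpha> (y + \<alpha> * C) = wiener_gain A \<alpha> * y"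
  by (simp add: bayes_decoder_def affine_fun_def algebra_simps)

lemma decoder_cost_affine:
  assumes [measurable]: "dec \<in> borel_measurable borel"
  shows "decoder_cost M x v w (affine_fun A C) \<alpha> dec =
    ennreal (mmse A \<alpha>) +
    (\<integral>\<^sup>+ \<omega>. ennreal ((bayes_decoder A C \<alpha> (received x v w (affine_fun A C) \<alpha> \<omega>) -
                    dec (received x v w (affine_fun A C) \<alpha> \<omega>))\<^sup>2) \<partial>M)"
  unfolding decoder_cost_def received_affine bayes_decoder_shift
  using estimation_error_decomposition[OF std_dev_pos(1) _ source_normal noise_normal indep_source_noise,
      of \<alpha> "\<lambda>r. dec (r + \<alpha> * C)" "gain A \<alpha>"] noise_var_pos[of \<alpha>]
  by (simp add: mmse_def wiener_gain_def received_var_def)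

text \<open>The two summands of the cost can be minimised separately: the first depends on \<open>\<alpha>\<close> only, and
for every \<open>\<alpha>\<close> the second is made zero by the Bayes decoder.\<close>

lemma optimal_decoder_iff:
  "optimal_decoder M x v w (affine_fun A C) \<alpha> dec \<longleftrightarrow>
    \<alpha> \<in> {0..1} \<and> dec \<in> borel_measurable borel \<and>
    (\<forall>\<alpha>' \<in> {0..1}. mmse A \<alpha> \<le> mmse A \<alpha>') \<and>
    (AE \<omega> in M. dec (received x v w (affine_fun A C) \<alpha> \<omega>) =
               bayes_decoder A C \<alpha> (received x v w (affine_fun A C) \<alpha> \<omega>))" (is "?L \<longleftrightarrow> ?R")
proof -
  have mpos: "0 \<le> mmse A \<alpha>" for \<alpha>
    using noise_var_pos[of \<alpha>] received_var_pos[of A \<alpha>] by (simp add: mmse_def)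
  have best: "decoder_cost M x v w (affine_fun A C) \<alpha> (bayes_decoder A C \<alpha>) = ennreal (mmse A \<alpha>)" for \<alpha>
    by (subst decoder_cost_affine) (simp_all add: measurable_bayes_decoder)
  show ?thesis
  proof
    assume L: ?L
    then have [measurable]: "dec \<in> borel_measurable borel" and a: "\<alpha> \<in> {0..1}"
      by (auto simp: optimal_decoder_def)
    let ?D = "\<integral>\<^sup>+ \<omega>. ennreal ((bayes_decoder A C \<alpha> (received x v w (affine_fun A C) \<alpha> \<omega>) -
                    dec (received x v w (affine_fun A C) \<alpha> \<omega>))\<^sup>2) \<partial>M"
    have le: "ennreal (mmse A \<alpha>) + ?D \<le> ennreal (mmse A \<alpha>')" if "\<alpha>' \<in> {0..1}" for \<alpha>'
    proof -
      have "decoder_cost M x v w (affine_fun A C) \<alpha> dec \<le>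
          decoder_cost M x v w (affine_fun A C) \<alpha>' (bayes_decoder A C \<alpha>')"
        using L that measurable_bayes_decoder unfolding optimal_decoder_def by blast
      then show ?thesis unfolding best by (subst (asm) decoder_cost_affine) simp_all
    qed
    have "?D = 0"
      using le[OF a] ennreal_add_left_cancel_le[of "ennreal (mmse A \<alpha>)" ?D 0] by simp
    then have "AE \<omega> in M. dec (received x v w (affine_fun A C) \<alpha> \<omega>) =
               bayes_decoder A C \<alpha> (received x v w (affine_fun A C) \<alpha> \<omega>)"
      by (subst (asm) nn_integral_0_iff_AE) (auto elim!: eventually_mono)
    moreover have "mmse A \<alpha> \<le> mmse A \<alpha>'" if "\<alpha>' \<in> {0..1}" for \<alpha>'
      using le[OF that] \<open>?D = 0\<close> mpos by simp
    ultimately show ?R using a by simp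
  next
    assume R: ?R
    then have [measurable]: "dec \<in> borel_measurable borel" by simp
    have D: "(\<integral>\<^sup>+ \<omega>. ennreal ((bayes_decoder A C \<alpha> (received x v w (affine_fun A C) \<alpha> \<omega>) -
                    dec (received x v w (affine_fun A C) \<alpha> \<omega>))\<^sup>2) \<partial>M) = 0"
      using R by (subst nn_integral_0_iff_AE) (auto elim!: eventually_mono)
    show ?L
      unfolding optimal_decoder_def
    proof (intro conjI ballI)
      fix \<alpha>' :: real and dec' :: "real \<Rightarrow> real" assume a': "\<alpha>' \<in> {0..1::real}" and [measurable]: "dec' \<in> borel_measurable borel"
      have "decoder_cost M x v w (affine_fun A C) \<alpha> dec = ennreal (mmse A \<alpha>)"
        by (simp add: decoder_cost_affine D)
      also have "\<dots> \<le> ennreal (mmse A \<alpha>')" using R a' by (simp add: ennreal_leI)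
      also have "\<dots> \<le> decoder_cost M x v w (affine_fun A C) \<alpha>' dec'"
        by (simp add: decoder_cost_affine)
      finally show "decoder_cost M x v w (affine_fun A C) \<alpha> dec
        \<le> decoder_cost M x v w (affine_fun A C) \<alpha>' dec'" .
    qed (use R in auto)
  qed
qed

lemma optimal_affine_decoder_iff:
  "optimal_decoder M x v w (affine_fun A C) \<alpha> (affine_fun K L) \<longleftrightarrow>
    \<alpha> \<in> {0..1} \<and> (\<forall>\<alpha>' \<in> {0..1}. mmse A \<alpha> \<le> mmse A \<alpha>') \<and>
    K = wiener_gain A \<alpha> \<and> L = - (K * \<alpha> * C)"
proof -
  have "K = wiener_gain A \<alpha> \<and> L = - (K * \<alpha> * C)"
    if "AE \<omega> in M. affine_fun K L (received x v w (affine_fun A C) \<alpha> \<omega>) =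
               bayes_decoder A C \<alpha> (received x v w (affine_fun A C) \<alpha> \<omega>)"
  proof -
    have "AE \<omega> in M. (K - wiener_gain A \<alpha>) * received x v w (affine_fun A C) \<alpha> \<omega>
        + (L + wiener_gain A \<alpha> * \<alpha> * C) = 0"
      using that by (rule AE_mp) (simp add: bayes_decoder_def affine_fun_def algebra_simps)
    from affine_received_AE_zero[OF this] show ?thesis by auto
  qed
  then show ?thesis
    unfolding optimal_decoder_iff by (auto simp: bayes_decoder_def)
qed

section \<open>Best responses of the encoder\<close>

text \<open>The value that \<open>\<alpha> * K * enc (x \<omega>)\<close> should take for the estimation error, including the bias, to
consist of noise only.\<close>

definition target :: "real \<Rightarrow> real \<Rightarrow> real \<Rightarrow> real \<Rightarrow> real \<Rightarrow> real"
  where "target b \<alpha> K L = affine_fun (1 - K * (1 - \<alpha>)) (- (L + b))"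

lemma measurable_target [measurable]: "target b \<alpha> K L \<in> borel_measurable borel"
  unfolding target_def by measurable

text \<open>An affine decoder passes the noise on additively. Since it is centred and independent of the
source, integrating it out leaves only the constant \<open>K\<^sup>2 * noise_var \<alpha>\<close>.\<close>

lemma encoder_cost_affine:
  assumes [measurable]: "enc \<in> borel_measurable borel" and "0 \<le> \<theta>"
  shows "encoder_cost M x v w \<theta> b enc \<alpha> (affine_fun K L) =
    (\<integral>\<^sup>+ \<omega>. ennreal (K\<^sup>2 * noise_var \<alpha> + (target b \<alpha> K L (x \<omega>) - \<alpha> * K * enc (x \<omega>))\<^sup>2
                  + \<theta> * (enc (x \<omega>))\<^sup>2) \<partial>M)"
proof -
  let ?c = "\<lambda>z. target b \<alpha> K L z - \<alpha> * K * enc z"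
  have "encoder_cost M x v w \<theta> b enc \<alpha> (affine_fun K L) =
    (\<integral>\<^sup>+ \<omega>. ennreal ((- K * (\<alpha> * v \<omega> + (1 - \<alpha>) * w \<omega>) + ?c (x \<omega>))\<^sup>2 + \<theta> * (enc (x \<omega>))\<^sup>2) \<partial>M)"
    unfolding encoder_cost_def
    by (intro nn_integral_cong arg_cong[where f = ennreal] arg_cong2[where f = "(+)"] arg_cong[where f = "\<lambda>z. z\<^sup>2"])
      (simp_all add: received_def affine_fun_def target_def algebra_simps)
  also have "\<dots> = (\<integral>\<^sup>+ z. ennreal (normal_density 0 \<sigma>x z) *
       (\<integral>\<^sup>+ y. ennreal (normal_density 0 (sqrt (noise_var \<alpha>)) y) *
          ennreal ((- K * y + ?c z)\<^sup>2 + \<theta> * (enc z)\<^sup>2) \<partial>lborel) \<partial>lborel)"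
    using noise_var_pos[of \<alpha>]
    by (intro nn_integral_indep_normal[OF std_dev_pos(1) _ source_normal noise_normal indep_source_noise,
          where F = "\<lambda>z y. ennreal ((- K * y + ?c z)\<^sup>2 + \<theta> * (enc z)\<^sup>2)"]) simp_all
  also have "\<dots> = (\<integral>\<^sup>+ z. ennreal (normal_density 0 \<sigma>x z) *
      ennreal (K\<^sup>2 * noise_var \<alpha> + (?c z)\<^sup>2 + \<theta> * (enc z)\<^sup>2) \<partial>lborel)"
    using noise_var_pos[of \<alpha>] assms(2) by (subst nn_integral_normal_density_square) simp_all
  also have "\<dots> = (\<integral>\<^sup>+ \<omega>. ennreal (K\<^sup>2 * noise_var \<alpha> + (?c (x \<omega>))\<^sup>2 + \<theta> * (enc (x \<omega>))\<^sup>2) \<partial>M)"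
    by (rule distributed_nn_integral[OF source_normal]) measurable
  finally show ?thesis .
qed

text \<open>The pointwise minimiser of \<open>(u - k e)\<^sup>2 + \<theta> e\<^sup>2\<close> in \<open>e\<close>, where \<open>k = \<alpha> K\<close> and \<open>u\<close> is the target; it
is affine because the target is.\<close>

definition best_encoder :: "real \<Rightarrow> real \<Rightarrow> real \<Rightarrow> real \<Rightarrow> real \<Rightarrow> real \<Rightarrow> real"
  where "best_encoder \<theta> b \<alpha> K L =
    affine_fun (\<alpha> * K * (1 - K * (1 - \<alpha>)) / ((\<alpha> * K)\<^sup>2 + \<theta>)) (- (\<alpha> * K * (L + b)) / ((\<alpha> * K)\<^sup>2 + \<theta>))"

lemma measurable_best_encoder [measurable]: "best_encoder \<theta> b \<alpha> K L \<in> borel_measurable borel"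
  unfolding best_encoder_def by measurable

lemma encoder_objective_square:
  fixes u k e \<theta> :: real
  assumes "0 < k\<^sup>2 + \<theta>"
  shows "(u - k * e)\<^sup>2 + \<theta> * e\<^sup>2 = \<theta> * u\<^sup>2 / (k\<^sup>2 + \<theta>) + (k\<^sup>2 + \<theta>) * (e - k * u / (k\<^sup>2 + \<theta>))\<^sup>2"
proof -
  have "(k\<^sup>2 + \<theta>) * (e - k * u / (k\<^sup>2 + \<theta>))\<^sup>2 = ((k\<^sup>2 + \<theta>) * e - k * u)\<^sup>2 / (k\<^sup>2 + \<theta>)"
  proof -
    have "e - k * u / (k\<^sup>2 + \<theta>) = ((k\<^sup>2 + \<theta>) * e - k * u) / (k\<^sup>2 + \<theta>)"
      using assms by (simp add: diff_divide_distrib)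
    then show ?thesis using assms by (simp add: power_divide) (simp add: power2_eq_square)
  qed
  moreover have "(k\<^sup>2 + \<theta>) * ((u - k * e)\<^sup>2 + \<theta> * e\<^sup>2) = \<theta> * u\<^sup>2 + ((k\<^sup>2 + \<theta>) * e - k * u)\<^sup>2"
    by algebra
  ultimately show ?thesis using assms
    by (simp only: add_divide_distrib[symmetric]) (simp only: eq_divide_eq mult.commute, simp)
qed

text \<open>Positivity of \<open>(\<alpha> K)\<^sup>2 + \<theta>\<close> makes the pointwise objective strictly convex. The cost at the
minimiser is finite, so it can be cancelled and the excess cost of an optimal encoder vanishes.\<close>

lemma optimal_encoder_iff:
  assumes "0 \<le> \<theta>" and pos: "0 < (\<alpha> * K)\<^sup>2 + \<theta>"
  shows "optimal_encoder M x v w \<theta> b \<alpha> (affine_fun K L) enc \<longleftrightarrow>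
    enc \<in> borel_measurable borel \<and> (AE \<omega> in M. enc (x \<omega>) = best_encoder \<theta> b \<alpha> K L (x \<omega>))"
proof -
  let ?q = "(\<alpha> * K)\<^sup>2 + \<theta>"
  let ?base = "\<lambda>\<omega>. K\<^sup>2 * noise_var \<alpha> + \<theta> * (target b \<alpha> K L (x \<omega>))\<^sup>2 / ?q"
  let ?D = "\<lambda>enc. \<integral>\<^sup>+ \<omega>. ennreal (?q * (enc (x \<omega>) - best_encoder \<theta> b \<alpha> K L (x \<omega>))\<^sup>2) \<partial>M"
  define B where "B = (\<integral>\<^sup>+ \<omega>. ennreal (?base \<omega>) \<partial>M)"
  have cost: "encoder_cost M x v w \<theta> b enc \<alpha> (affine_fun K L) = B + ?D enc"
    if [measurable]: "enc \<in> borel_measurable borel" for enc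
  proof -
    have "encoder_cost M x v w \<theta> b enc \<alpha> (affine_fun K L) =
      (\<integral>\<^sup>+ \<omega>. ennreal (?base \<omega>) + ennreal (?q * (enc (x \<omega>) - best_encoder \<theta> b \<alpha> K L (x \<omega>))\<^sup>2) \<partial>M)"
      unfolding encoder_cost_affine[OF that assms(1)]
    proof (rule nn_integral_cong)
      fix \<omega>
      have "best_encoder \<theta> b \<alpha> K L (x \<omega>) = \<alpha> * K * target b \<alpha> K L (x \<omega>) / ?q"
        by (simp add: best_encoder_def affine_fun_def target_def add_divide_distrib[symmetric]
            diff_divide_distrib[symmetric]) (simp add: algebra_simps)
      then have "K\<^sup>2 * noise_var \<alpha> + (target b \<alpha> K L (x \<omega>) - \<alpha> * K * enc (x \<omega>))\<^sup>2 + \<theta> * (enc (x \<omega>))\<^sup>2 =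
         ?base \<omega> + ?q * (enc (x \<omega>) - best_encoder \<theta> b \<alpha> K L (x \<omega>))\<^sup>2"
        using encoder_objective_square[OF pos, of "target b \<alpha> K L (x \<omega>)" "enc (x \<omega>)"] by simp
      then show "ennreal (K\<^sup>2 * noise_var \<alpha> + (target b \<alpha> K L (x \<omega>) - \<alpha> * K * enc (x \<omega>))\<^sup>2 + \<theta> * (enc (x \<omega>))\<^sup>2) =
         ennreal (?base \<omega>) + ennreal (?q * (enc (x \<omega>) - best_encoder \<theta> b \<alpha> K L (x \<omega>))\<^sup>2)"
        using pos assms(1) noise_var_pos[of \<alpha>] by (simp add: ennreal_plus[symmetric] del: ennreal_plus)
    qed
    then show ?thesis unfolding B_def by (simp add: nn_integral_add)
  qed
  have "B \<noteq> \<top>"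
  proof -
    have "B = ennreal (K\<^sup>2 * noise_var \<alpha>) +
        ennreal (\<theta> / ?q) * (\<integral>\<^sup>+ \<omega>. ennreal ((target b \<alpha> K L (x \<omega>))\<^sup>2) \<partial>M)"
      unfolding B_def using pos assms(1) noise_var_pos[of \<alpha>]
      by (simp add: nn_integral_add emeasure_space_1 nn_integral_cmult[symmetric] ennreal_mult[symmetric])
    also have "(\<integral>\<^sup>+ \<omega>. ennreal ((target b \<alpha> K L (x \<omega>))\<^sup>2) \<partial>M) =
        ennreal ((1 - K * (1 - \<alpha>))\<^sup>2 * \<sigma>x\<^sup>2 + (- (L + b))\<^sup>2)"
      unfolding nn_integral_affine_source[symmetric] by (simp only: target_def affine_fun_def)
    finally show ?thesis by (simp add: ennreal_mult_eq_top_iff)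
  qed
  have zero: "?D enc = 0 \<longleftrightarrow> (AE \<omega> in M. enc (x \<omega>) = best_encoder \<theta> b \<alpha> K L (x \<omega>))"
    if [measurable]: "enc \<in> borel_measurable borel" for enc
    using pos by (subst nn_integral_0_iff_AE) (simp_all add: ennreal_eq_0_iff mult_le_0_iff not_le)
  show ?thesis
  proof
    assume L: "optimal_encoder M x v w \<theta> b \<alpha> (affine_fun K L) enc"
    then have m: "enc \<in> borel_measurable borel" by (simp add: optimal_encoder_def)
    have "B + ?D enc \<le> B + ?D (best_encoder \<theta> b \<alpha> K L)"
      using L unfolding optimal_encoder_def
      by (simp only: cost[OF m, symmetric] cost[OF measurable_best_encoder, symmetric] measurable_best_encoder)
    then have "?D enc = 0"
      using \<open>B \<noteq> \<top>\<close> by (simp add: ennreal_add_left_cancel_le)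
    then show "enc \<in> borel_measurable borel \<and> (AE \<omega> in M. enc (x \<omega>) = best_encoder \<theta> b \<alpha> K L (x \<omega>))"
      using zero m by simp
  next
    assume R: "enc \<in> borel_measurable borel \<and> (AE \<omega> in M. enc (x \<omega>) = best_encoder \<theta> b \<alpha> K L (x \<omega>))"
    then have "?D enc = 0" using zero by simp
    with R show "optimal_encoder M x v w \<theta> b \<alpha> (affine_fun K L) enc"
      by (simp add: optimal_encoder_def cost)
  qed
qed

text \<open>Without a power constraint, an encoder whose signal the decoder ignores cannot influence
its own cost.\<close>

lemma optimal_encoder_indifferent:
  assumes "\<alpha> * K = 0" "enc \<in> borel_measurable borel"
  shows "optimal_encoder M x v w 0 b \<alpha> (affine_fun K L) enc"
proof -
  have "encoder_cost M x v w 0 b e \<alpha> (affine_fun K L) =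
      (\<integral>\<^sup>+ \<omega>. ennreal (K\<^sup>2 * noise_var \<alpha> + (target b \<alpha> K L (x \<omega>))\<^sup>2) \<partial>M)"
    if "e \<in> borel_measurable borel" for e
    by (simp add: encoder_cost_affine that assms(1) del: mult_eq_0_iff)
  then show ?thesis
    using assms(2) by (simp add: optimal_encoder_def)
qed

lemma optimal_affine_encoder_iff:
  assumes "0 \<le> \<theta>" and pos: "0 < (\<alpha> * K)\<^sup>2 + \<theta>"
  shows "optimal_encoder M x v w \<theta> b \<alpha> (affine_fun K L) (affine_fun A C) \<longleftrightarrow>
    A * ((\<alpha> * K)\<^sup>2 + \<theta>) = \<alpha> * K * (1 - K * (1 - \<alpha>)) \<and> C * ((\<alpha> * K)\<^sup>2 + \<theta>) = - (\<alpha> * K * (L + b))"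
    (is "_ \<longleftrightarrow> ?R")
proof -
  let ?q = "(\<alpha> * K)\<^sup>2 + \<theta>"
  have R: "?R \<longleftrightarrow> A = \<alpha> * K * (1 - K * (1 - \<alpha>)) / ?q \<and> C = - (\<alpha> * K * (L + b)) / ?q"
    using pos by (simp only: eq_divide_eq) simp
  have "A = \<alpha> * K * (1 - K * (1 - \<alpha>)) / ?q \<and> C = - (\<alpha> * K * (L + b)) / ?q"
    if "AE \<omega> in M. affine_fun A C (x \<omega>) = best_encoder \<theta> b \<alpha> K L (x \<omega>)"
  proof -
    have "AE \<omega> in M. (A - \<alpha> * K * (1 - K * (1 - \<alpha>)) / ?q) * x \<omega> + (C - - (\<alpha> * K * (L + b)) / ?q) = 0"
      using that by (rule AE_mp) (simp add: best_encoder_def affine_fun_def algebra_simps)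
    from affine_source_AE_zero[OF this] show ?thesis by auto
  qed
  then show ?thesis
    unfolding optimal_encoder_iff[OF assms] R by (auto simp: best_encoder_def measurable_affine_fun)
qed

section \<open>The optimal combining parameter\<close>

text \<open>Minimising the posterior variance is maximising the signal-to-noise ratio
\<open>(gain A \<alpha>)\<^sup>2 / noise_var \<alpha>\<close>, compared here after cross-multiplication.\<close>

lemma mmse_le_iff:
  "mmse A \<alpha> \<le> mmse A \<alpha>' \<longleftrightarrow> (gain A \<alpha>')\<^sup>2 * noise_var \<alpha> \<le> (gain A \<alpha>)\<^sup>2 * noise_var \<alpha>'"
proof -
  have "mmse A \<alpha> \<le> mmse A \<alpha>' \<longleftrightarrow>
      \<sigma>x\<^sup>2 * noise_var \<alpha> * received_var A \<alpha>' \<le> \<sigma>x\<^sup>2 * noise_var \<alpha>' * received_var A \<alpha>"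
    using received_var_pos[of A \<alpha>] received_var_pos[of A \<alpha>'] unfolding mmse_def
    by (simp add: divide_le_eq le_divide_eq)
  also have "\<dots> \<longleftrightarrow> noise_var \<alpha> * received_var A \<alpha>' \<le> noise_var \<alpha>' * received_var A \<alpha>"
    using std_dev_pos by (simp add: mult.assoc)
  also have "\<dots> \<longleftrightarrow> \<sigma>x\<^sup>2 * ((gain A \<alpha>')\<^sup>2 * noise_var \<alpha>) \<le> \<sigma>x\<^sup>2 * ((gain A \<alpha>)\<^sup>2 * noise_var \<alpha>')"
    by (simp add: received_var_def algebra_simps)
  also have "\<dots> \<longleftrightarrow> (gain A \<alpha>')\<^sup>2 * noise_var \<alpha> \<le> (gain A \<alpha>)\<^sup>2 * noise_var \<alpha>'"
    using std_dev_pos by simp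
  finally show ?thesis .
qed

lemma mmse_minimizer_iff:
  assumes bound: "\<And>\<beta>. \<beta> \<in> {0..1} \<Longrightarrow> (gain A \<beta>)\<^sup>2 \<le> m * noise_var \<beta>"
    and attained: "\<alpha>0 \<in> {0..1}" "(gain A \<alpha>0)\<^sup>2 = m * noise_var \<alpha>0"
    and "\<alpha> \<in> {0..1}"
  shows "(\<forall>\<beta> \<in> {0..1}. mmse A \<alpha> \<le> mmse A \<beta>) \<longleftrightarrow> (gain A \<alpha>)\<^sup>2 = m * noise_var \<alpha>"
proof
  assume "\<forall>\<beta> \<in> {0..1}. mmse A \<alpha> \<le> mmse A \<beta>"
  then have "mmse A \<alpha> \<le> mmse A \<alpha>0" using attained(1) by blast
  then have "noise_var \<alpha>0 * (m * noise_var \<alpha>) \<le> noise_var \<alpha>0 * (gain A \<alpha>)\<^sup>2"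
    by (simp add: mmse_le_iff attained(2) ac_simps)
  then have "m * noise_var \<alpha> \<le> (gain A \<alpha>)\<^sup>2"
    using noise_var_pos[of \<alpha>0] by simp
  with bound[OF \<open>\<alpha> \<in> {0..1}\<close>] show "(gain A \<alpha>)\<^sup>2 = m * noise_var \<alpha>" by simp
next
  assume eq: "(gain A \<alpha>)\<^sup>2 = m * noise_var \<alpha>"
  show "\<forall>\<beta> \<in> {0..1}. mmse A \<alpha> \<le> mmse A \<beta>"
  proof
    fix \<beta> :: real assume "\<beta> \<in> {0..1}"
    then have "(gain A \<beta>)\<^sup>2 * noise_var \<alpha> \<le> m * noise_var \<beta> * noise_var \<alpha>"
      using bound noise_var_pos[of \<alpha>] by (intro mult_right_mono) auto
    then show "mmse A \<alpha> \<le> mmse A \<beta>" by (simp add: mmse_le_iff eq ac_simps)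
  qed
qed

text \<open>Maximal-ratio combining: each branch is weighted in proportion to its signal amplitude divided by
its noise variance, that is \<open>\<alpha> : (1 - \<alpha>) = A / \<sigma>v\<^sup>2 : 1 / \<sigma>w\<^sup>2\<close>.\<close>

definition matched_weight :: "real \<Rightarrow> real"
  where "matched_weight A = A * \<sigma>w\<^sup>2 / (A * \<sigma>w\<^sup>2 + \<sigma>v\<^sup>2)"

lemma matched_weight_range: "0 \<le> A \<Longrightarrow> matched_weight A \<in> {0..1}"
  using std_dev_pos by (simp add: matched_weight_def divide_le_eq_1 add_nonneg_pos)

text \<open>Cauchy-Schwarz: \<open>slack\<close> is the Lagrange identity for the vectors
\<open>(\<beta> \<sigma>v, (1 - \<beta>) \<sigma>w)\<close> and \<open>(A / \<sigma>v, 1 / \<sigma>w)\<close>, so the bound is attained only when they are parallel.\<close>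

lemma optimal_weight_nonneg:
  assumes "0 \<le> A" "\<alpha> \<in> {0..1}"
  shows "(\<forall>\<beta> \<in> {0..1}. mmse A \<alpha> \<le> mmse A \<beta>) \<longleftrightarrow> \<alpha> = matched_weight A"
proof -
  let ?m = "A\<^sup>2 / \<sigma>v\<^sup>2 + 1 / \<sigma>w\<^sup>2"
  have slack: "?m * noise_var \<beta> - (gain A \<beta>)\<^sup>2 = ((1 - \<beta>) * \<sigma>w\<^sup>2 * A - \<beta> * \<sigma>v\<^sup>2)\<^sup>2 / (\<sigma>v\<^sup>2 * \<sigma>w\<^sup>2)" for \<beta>
  proof -
    have "?m * noise_var \<beta> - (gain A \<beta>)\<^sup>2 =
        ((A\<^sup>2 * \<sigma>w\<^sup>2 + \<sigma>v\<^sup>2) * noise_var \<beta> - (gain A \<beta>)\<^sup>2 * (\<sigma>v\<^sup>2 * \<sigma>w\<^sup>2)) / (\<sigma>v\<^sup>2 * \<sigma>w\<^sup>2)"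
      using std_dev_pos by (simp add: field_simps)
    also have "(A\<^sup>2 * \<sigma>w\<^sup>2 + \<sigma>v\<^sup>2) * noise_var \<beta> - (gain A \<beta>)\<^sup>2 * (\<sigma>v\<^sup>2 * \<sigma>w\<^sup>2) =
        ((1 - \<beta>) * \<sigma>w\<^sup>2 * A - \<beta> * \<sigma>v\<^sup>2)\<^sup>2"
      unfolding noise_var_def gain_def by algebra
    finally show ?thesis .
  qed
  have eq: "(gain A \<beta>)\<^sup>2 = ?m * noise_var \<beta> \<longleftrightarrow> \<beta> = matched_weight A" for \<beta>
  proof -
    have d: "0 < A * \<sigma>w\<^sup>2 + \<sigma>v\<^sup>2" using assms std_dev_pos by (simp add: add_nonneg_pos)
    have "(gain A \<beta>)\<^sup>2 = ?m * noise_var \<beta> \<longleftrightarrow> (1 - \<beta>) * \<sigma>w\<^sup>2 * A - \<beta> * \<sigma>v\<^sup>2 = 0"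
      using slack[of \<beta>] std_dev_pos by auto
    also have "\<dots> \<longleftrightarrow> \<beta> * (A * \<sigma>w\<^sup>2 + \<sigma>v\<^sup>2) = A * \<sigma>w\<^sup>2"
      by (auto simp: algebra_simps)
    also have "\<dots> \<longleftrightarrow> \<beta> = matched_weight A"
      using d by (simp add: matched_weight_def eq_divide_eq)
    finally show ?thesis .
  qed
  have "(gain A \<beta>)\<^sup>2 \<le> ?m * noise_var \<beta>" for \<beta>
  proof -
    have "0 \<le> ?m * noise_var \<beta> - (gain A \<beta>)\<^sup>2"
      unfolding slack using std_dev_pos by simp
    then show ?thesis by simp
  qed
  from mmse_minimizer_iff[OF this matched_weight_range[OF assms(1)] _ assms(2)] eq
  show ?thesis by simp
qed

text \<open>For \<open>A < 0\<close> the cross term \<open>2 \<beta> (1 - \<beta>) A\<close> of \<open>(gain A \<beta>)\<^sup>2\<close> is negative strictly between the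
endpoints. Dropping it bounds the signal-to-noise ratio by that of the better single branch, and
mixing is strictly worse.\<close>

lemma optimal_weight_neg:
  assumes "A < 0" "\<alpha> \<in> {0..1}"
  shows "(\<forall>\<beta> \<in> {0..1}. mmse A \<alpha> \<le> mmse A \<beta>) \<longleftrightarrow>
    \<alpha> = 0 \<and> A\<^sup>2 / \<sigma>v\<^sup>2 \<le> 1 / \<sigma>w\<^sup>2 \<or> \<alpha> = 1 \<and> 1 / \<sigma>w\<^sup>2 \<le> A\<^sup>2 / \<sigma>v\<^sup>2"
proof -
  define m where "m = max (A\<^sup>2 / \<sigma>v\<^sup>2) (1 / \<sigma>w\<^sup>2)"
  have m: "A\<^sup>2 \<le> m * \<sigma>v\<^sup>2" "1 \<le> m * \<sigma>w\<^sup>2"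
    using std_dev_pos by (simp_all add: m_def pos_divide_le_eq[symmetric])
  have bound: "(gain A \<beta>)\<^sup>2 \<le> m * noise_var \<beta> - 2 * \<beta> * (1 - \<beta>) * (- A)" for \<beta>
  proof -
    have "(gain A \<beta>)\<^sup>2 = \<beta>\<^sup>2 * A\<^sup>2 + (1 - \<beta>)\<^sup>2 * 1 - 2 * \<beta> * (1 - \<beta>) * (- A)"
      by (simp add: gain_def power2_eq_square algebra_simps)
    also have "\<dots> \<le> \<beta>\<^sup>2 * (m * \<sigma>v\<^sup>2) + (1 - \<beta>)\<^sup>2 * (m * \<sigma>w\<^sup>2) - 2 * \<beta> * (1 - \<beta>) * (- A)"
      using m by (intro diff_right_mono add_mono mult_left_mono) auto
    finally show ?thesis by (simp add: noise_var_def algebra_simps)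
  qed
  have bound': "(gain A \<beta>)\<^sup>2 \<le> m * noise_var \<beta>" if "\<beta> \<in> {0..1}" for \<beta>
  proof -
    have "0 \<le> 2 * \<beta> * (1 - \<beta>) * (- A)"
      using that assms(1) by (intro mult_nonneg_nonneg) auto
    with bound[of \<beta>] show ?thesis by linarith
  qed
  have eq0: "(gain A 0)\<^sup>2 = m * noise_var 0 \<longleftrightarrow> A\<^sup>2 / \<sigma>v\<^sup>2 \<le> 1 / \<sigma>w\<^sup>2"
    and eq1: "(gain A 1)\<^sup>2 = m * noise_var 1 \<longleftrightarrow> 1 / \<sigma>w\<^sup>2 \<le> A\<^sup>2 / \<sigma>v\<^sup>2"
  proof -
    have "(gain A 0)\<^sup>2 = m * noise_var 0 \<longleftrightarrow> m = 1 / \<sigma>w\<^sup>2"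
      using std_dev_pos by (auto simp: gain_def noise_var_def eq_divide_eq)
    then show "(gain A 0)\<^sup>2 = m * noise_var 0 \<longleftrightarrow> A\<^sup>2 / \<sigma>v\<^sup>2 \<le> 1 / \<sigma>w\<^sup>2"
      by (auto simp: m_def max_def)
    have "(gain A 1)\<^sup>2 = m * noise_var 1 \<longleftrightarrow> m = A\<^sup>2 / \<sigma>v\<^sup>2"
      using std_dev_pos by (auto simp: gain_def noise_var_def eq_divide_eq)
    then show "(gain A 1)\<^sup>2 = m * noise_var 1 \<longleftrightarrow> 1 / \<sigma>w\<^sup>2 \<le> A\<^sup>2 / \<sigma>v\<^sup>2"
      by (auto simp: m_def max_def)
  qed
  obtain \<alpha>0 where "\<alpha>0 \<in> {0..1}" "(gain A \<alpha>0)\<^sup>2 = m * noise_var \<alpha>0"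
  proof (cases "A\<^sup>2 / \<sigma>v\<^sup>2 \<le> 1 / \<sigma>w\<^sup>2")
    case True
    then show ?thesis using eq0 that[of 0] by simp
  next
    case False
    then show ?thesis using eq1 that[of 1] by simp
  qed
  from mmse_minimizer_iff[OF bound' this assms(2)]
  have iff: "(\<forall>\<beta> \<in> {0..1}. mmse A \<alpha> \<le> mmse A \<beta>) \<longleftrightarrow> (gain A \<alpha>)\<^sup>2 = m * noise_var \<alpha>" .
  have "\<alpha> = 0 \<or> \<alpha> = 1" if "(gain A \<alpha>)\<^sup>2 = m * noise_var \<alpha>"
  proof (rule ccontr)
    assume "\<not> (\<alpha> = 0 \<or> \<alpha> = 1)"
    then have "0 < 2 * \<alpha> * (1 - \<alpha>) * (- A)"
      using assms by (intro mult_pos_pos) auto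
    with bound[of \<alpha>] that show False by linarith
  qed
  then show ?thesis unfolding iff using eq0 eq1 by auto
qed

lemma optimal_weight_exists: "\<exists>\<alpha>\<in>{0..1}. \<forall>\<beta>\<in>{0..1}. mmse A \<alpha> \<le> mmse A \<beta>"
proof (cases "0 \<le> A")
  case True
  then show ?thesis using optimal_weight_nonneg matched_weight_range by blast
next
  case False
  then have "A < 0" by simp
  from optimal_weight_neg[OF this, of 0] optimal_weight_neg[OF this, of 1]
  have "(\<forall>\<beta>\<in>{0..1}. mmse A 0 \<le> mmse A \<beta>) \<or> (\<forall>\<beta>\<in>{0..1}. mmse A 1 \<le> mmse A \<beta>)"
    by auto
  then show ?thesis by (metis atLeastAtMost_iff order_refl zero_le_one)
qed

section \<open>Affine equilibria\<close>

text \<open>Substituting \<open>L = - \<alpha> K C\<close> from the decoder into the encoder's condition for \<open>C\<close> cancels the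
terms in \<open>(\<alpha> K)\<^sup>2 C\<close> and leaves \<open>\<theta> C = - \<alpha> K b\<close>; so the offsets are explicit and do not interact with the
equation for the slopes.\<close>

lemma affine_equilibrium_iff:
  assumes "0 < \<theta>"
  shows "(A, C, K, L, \<alpha>) \<in> affine_equilibria M x v w \<theta> b \<longleftrightarrow>
    \<alpha> \<in> {0..1} \<and> (\<forall>\<beta> \<in> {0..1}. mmse A \<alpha> \<le> mmse A \<beta>) \<and> K = wiener_gain A \<alpha> \<and>
    A * ((\<alpha> * K)\<^sup>2 + \<theta>) = \<alpha> * K * (1 - K * (1 - \<alpha>)) \<and>
    C = - (\<alpha> * K * b / \<theta>) \<and> L = \<alpha>\<^sup>2 * K\<^sup>2 * b / \<theta>"
proof -
  have pos: "0 < (\<alpha> * K)\<^sup>2 + \<theta>" using assms by (simp add: add_nonneg_pos)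
  have "L = - (K * \<alpha> * C) \<and> C * ((\<alpha> * K)\<^sup>2 + \<theta>) = - (\<alpha> * K * (L + b)) \<longleftrightarrow>
      C = - (\<alpha> * K * b / \<theta>) \<and> L = \<alpha>\<^sup>2 * K\<^sup>2 * b / \<theta>" (is "?l \<longleftrightarrow> ?r")
  proof
    assume l: ?l
    then have "C * ((\<alpha> * K)\<^sup>2 + \<theta>) = - (\<alpha> * K * (- (K * \<alpha> * C) + b))" by simp
    then have "C * \<theta> = - (\<alpha> * K * b)" by (simp add: power2_eq_square algebra_simps)
    then have "C = - (\<alpha> * K * b / \<theta>)" using assms by (simp add: field_simps)
    with l show ?r using assms by (simp add: power2_eq_square)
  next
    assume ?r
    then have L: "L = - (K * \<alpha> * C)" and "C * \<theta> = - (\<alpha> * K * b)"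
      using assms by (simp_all add: power2_eq_square)
    then have "C * ((\<alpha> * K)\<^sup>2 + \<theta>) = - (\<alpha> * K * (L + b))" by algebra
    with L show ?l by simp
  qed
  then show ?thesis
    unfolding affine_equilibria_def nash_equilibrium_def
    using optimal_affine_encoder_iff[OF less_imp_le[OF assms] pos, of b L A C]
      optimal_affine_decoder_iff[of A C \<alpha> K L] by auto
qed

lemma wiener_gain_matched:
  assumes "0 < A"
  shows "wiener_gain A (matched_weight A) =
    (A * \<sigma>w\<^sup>2 + \<sigma>v\<^sup>2) * \<sigma>x\<^sup>2 / (\<sigma>x\<^sup>2 * (A\<^sup>2 * \<sigma>w\<^sup>2 + \<sigma>v\<^sup>2) + \<sigma>v\<^sup>2 * \<sigma>w\<^sup>2)" (is "_ = ?D * _ / ?E")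
proof -
  have D: "0 < ?D" and E: "0 < ?E" and F: "0 < A\<^sup>2 * \<sigma>w\<^sup>2 + \<sigma>v\<^sup>2"
    using assms std_dev_pos by (simp_all add: add_pos_pos)
  have b: "1 - matched_weight A = \<sigma>v\<^sup>2 / ?D"
    using D by (simp add: matched_weight_def field_simps)
  have g: "gain A (matched_weight A) = (A\<^sup>2 * \<sigma>w\<^sup>2 + \<sigma>v\<^sup>2) / ?D"
    unfolding gain_def b by (simp add: matched_weight_def add_divide_distrib power2_eq_square)
  have "noise_var (matched_weight A) = \<sigma>v\<^sup>2 * \<sigma>w\<^sup>2 * (A\<^sup>2 * \<sigma>w\<^sup>2 + \<sigma>v\<^sup>2) / ?D\<^sup>2"
  proof -
    have "noise_var (matched_weight A) = ((A * \<sigma>w\<^sup>2)\<^sup>2 * \<sigma>v\<^sup>2 + (\<sigma>v\<^sup>2)\<^sup>2 * \<sigma>w\<^sup>2) / ?D\<^sup>2"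
      unfolding noise_var_def b unfolding matched_weight_def by (simp add: power_divide add_divide_distrib)
    also have "(A * \<sigma>w\<^sup>2)\<^sup>2 * \<sigma>v\<^sup>2 + (\<sigma>v\<^sup>2)\<^sup>2 * \<sigma>w\<^sup>2 = \<sigma>v\<^sup>2 * \<sigma>w\<^sup>2 * (A\<^sup>2 * \<sigma>w\<^sup>2 + \<sigma>v\<^sup>2)"
      by algebra
    finally show ?thesis .
  qed
  then have "received_var A (matched_weight A) = (A\<^sup>2 * \<sigma>w\<^sup>2 + \<sigma>v\<^sup>2) * ?E / ?D\<^sup>2"
    unfolding received_var_def g
    by (simp add: power_divide add_divide_distrib[symmetric]) (simp add: power2_eq_square algebra_simps)
  then show ?thesis
    unfolding wiener_gain_def g using D E F by (simp add: power2_eq_square)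
qed

lemma clear_denominator_iff:
  fixes A k u E \<theta> :: real
  assumes "E \<noteq> 0"
  shows "A * ((k / E)\<^sup>2 + \<theta>) = k / E * (u / E) \<longleftrightarrow> A * (k\<^sup>2 + \<theta> * E\<^sup>2) = k * u"
  using assms by (simp add: field_simps power2_eq_square)

text \<open>With the matched weight substituted, both sides of the slope equation carry the factor \<open>A\<close> and
the terms in \<open>A\<^sup>2\<close> outside the denominator cancel, which leaves an equation that determines that
denominator.\<close>

lemma equilibrium_pos_iff:
  assumes "0 < \<theta>" "0 < A"
  shows "(A, C, K, L, \<alpha>) \<in> affine_equilibria M x v w \<theta> b \<longleftrightarrow>
    \<theta> * (\<sigma>x\<^sup>2 * (A\<^sup>2 * \<sigma>w\<^sup>2 + \<sigma>v\<^sup>2) + \<sigma>v\<^sup>2 * \<sigma>w\<^sup>2)\<^sup>2 = (\<sigma>w\<^sup>2)\<^sup>2 * \<sigma>x\<^sup>2 * \<sigma>v\<^sup>2 \<and>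
    \<alpha> = matched_weight A \<and>
    K = (A * \<sigma>w\<^sup>2 + \<sigma>v\<^sup>2) * \<sigma>x\<^sup>2 / (\<sigma>x\<^sup>2 * (A\<^sup>2 * \<sigma>w\<^sup>2 + \<sigma>v\<^sup>2) + \<sigma>v\<^sup>2 * \<sigma>w\<^sup>2) \<and>
    C = - (\<alpha> * K * b / \<theta>) \<and> L = \<alpha>\<^sup>2 * K\<^sup>2 * b / \<theta>"
proof -
  let ?D = "A * \<sigma>w\<^sup>2 + \<sigma>v\<^sup>2" and ?E = "\<sigma>x\<^sup>2 * (A\<^sup>2 * \<sigma>w\<^sup>2 + \<sigma>v\<^sup>2) + \<sigma>v\<^sup>2 * \<sigma>w\<^sup>2"
  have D: "0 < ?D" and E: "0 < ?E"
    using assms std_dev_pos by (simp_all add: add_pos_pos)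
  have stat: "A * ((\<alpha> * K)\<^sup>2 + \<theta>) = \<alpha> * K * (1 - K * (1 - \<alpha>)) \<longleftrightarrow>
      \<theta> * ?E\<^sup>2 = (\<sigma>w\<^sup>2)\<^sup>2 * \<sigma>x\<^sup>2 * \<sigma>v\<^sup>2"
    if a: "\<alpha> = matched_weight A" and K: "K = ?D * \<sigma>x\<^sup>2 / ?E"
  proof -
    have k: "\<alpha> * K = A * \<sigma>w\<^sup>2 * \<sigma>x\<^sup>2 / ?E"
      using D by (simp add: a K matched_weight_def)
    have "K * (1 - \<alpha>) = \<sigma>v\<^sup>2 * \<sigma>x\<^sup>2 / ?E"
    proof -
      have "1 - \<alpha> = \<sigma>v\<^sup>2 / ?D" using D by (simp add: a matched_weight_def field_simps)
      then show ?thesis using D by (simp add: K)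
    qed
    then have u: "1 - K * (1 - \<alpha>) = \<sigma>w\<^sup>2 * (\<sigma>x\<^sup>2 * A\<^sup>2 + \<sigma>v\<^sup>2) / ?E"
      using E by (simp add: eq_divide_eq left_diff_distrib) (simp add: algebra_simps)
    have "A * ((\<alpha> * K)\<^sup>2 + \<theta>) = \<alpha> * K * (1 - K * (1 - \<alpha>)) \<longleftrightarrow>
        A * ((A * \<sigma>w\<^sup>2 * \<sigma>x\<^sup>2)\<^sup>2 + \<theta> * ?E\<^sup>2) = A * \<sigma>w\<^sup>2 * \<sigma>x\<^sup>2 * (\<sigma>w\<^sup>2 * (\<sigma>x\<^sup>2 * A\<^sup>2 + \<sigma>v\<^sup>2))"
      unfolding u k using E by (intro clear_denominator_iff) simp
    also have "\<dots> \<longleftrightarrow> (A * \<sigma>w\<^sup>2 * \<sigma>x\<^sup>2)\<^sup>2 + \<theta> * ?E\<^sup>2 = \<sigma>w\<^sup>2 * \<sigma>x\<^sup>2 * (\<sigma>w\<^sup>2 * (\<sigma>x\<^sup>2 * A\<^sup>2 + \<sigma>v\<^sup>2))"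
      using assms by (simp only: mult.assoc mult_cancel_left) simp
    also have "\<sigma>w\<^sup>2 * \<sigma>x\<^sup>2 * (\<sigma>w\<^sup>2 * (\<sigma>x\<^sup>2 * A\<^sup>2 + \<sigma>v\<^sup>2)) =
        (A * \<sigma>w\<^sup>2 * \<sigma>x\<^sup>2)\<^sup>2 + (\<sigma>w\<^sup>2)\<^sup>2 * \<sigma>x\<^sup>2 * \<sigma>v\<^sup>2"
      by algebra
    finally show ?thesis by simp
  qed
  show ?thesis
    unfolding affine_equilibrium_iff[OF assms(1)]
    using optimal_weight_nonneg[of A \<alpha>] matched_weight_range[of A] wiener_gain_matched[OF assms(2)]
      assms(2) stat by auto
qed

text \<open>The other endpoint \<open>\<alpha> = 0\<close> is excluded because it makes the encoder send nothing,
contradicting \<open>A < 0\<close>.\<close>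

lemma equilibrium_neg_iff:
  assumes "0 < \<theta>" "A < 0"
  shows "(A, C, K, L, \<alpha>) \<in> affine_equilibria M x v w \<theta> b \<longleftrightarrow>
    \<theta> * (A\<^sup>2 * \<sigma>x\<^sup>2 + \<sigma>v\<^sup>2)\<^sup>2 = \<sigma>x\<^sup>2 * \<sigma>v\<^sup>2 \<and> 1 / \<sigma>w\<^sup>2 \<le> A\<^sup>2 / \<sigma>v\<^sup>2 \<and>
    \<alpha> = 1 \<and> K = A * \<sigma>x\<^sup>2 / (A\<^sup>2 * \<sigma>x\<^sup>2 + \<sigma>v\<^sup>2) \<and> C = - (K * b / \<theta>) \<and> L = K\<^sup>2 * b / \<theta>"
proof -
  let ?E = "A\<^sup>2 * \<sigma>x\<^sup>2 + \<sigma>v\<^sup>2"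
  have E: "0 < ?E" using std_dev_pos by (simp add: add_nonneg_pos)
  have w: "wiener_gain A 1 = A * \<sigma>x\<^sup>2 / ?E"
    by (simp add: wiener_gain_def gain_def received_var_def noise_var_def)
  have stat: "A * (K\<^sup>2 + \<theta>) = K \<longleftrightarrow> \<theta> * ?E\<^sup>2 = \<sigma>x\<^sup>2 * \<sigma>v\<^sup>2" if K: "K = A * \<sigma>x\<^sup>2 / ?E"
  proof -
    have "A * (K\<^sup>2 + \<theta>) = K \<longleftrightarrow> A * ((A * \<sigma>x\<^sup>2)\<^sup>2 + \<theta> * ?E\<^sup>2) = A * \<sigma>x\<^sup>2 * ?E"
      using clear_denominator_iff[of ?E A "A * \<sigma>x\<^sup>2" \<theta> ?E] E by (simp add: K)
    also have "\<dots> \<longleftrightarrow> (A * \<sigma>x\<^sup>2)\<^sup>2 + \<theta> * ?E\<^sup>2 = \<sigma>x\<^sup>2 * ?E"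
      using assms by (simp only: mult.assoc mult_cancel_left) simp
    also have "\<sigma>x\<^sup>2 * ?E = (A * \<sigma>x\<^sup>2)\<^sup>2 + \<sigma>x\<^sup>2 * \<sigma>v\<^sup>2"
      by algebra
    finally show ?thesis by simp
  qed
  show ?thesis
    unfolding affine_equilibrium_iff[OF assms(1)]
    using optimal_weight_neg[OF assms(2), of \<alpha>] w assms stat by auto
qed

lemma equilibrium_zero_iff:
  assumes "0 < \<theta>"
  shows "(0, C, K, L, \<alpha>) \<in> affine_equilibria M x v w \<theta> b \<longleftrightarrow>
    (C, K, L, \<alpha>) = (0, \<sigma>x\<^sup>2 / (\<sigma>x\<^sup>2 + \<sigma>w\<^sup>2), 0, 0)"
proof -
  have w: "wiener_gain 0 0 = \<sigma>x\<^sup>2 / (\<sigma>x\<^sup>2 + \<sigma>w\<^sup>2)"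
    by (simp add: wiener_gain_def gain_def received_var_def noise_var_def)
  have m: "matched_weight 0 = 0" by (simp add: matched_weight_def)
  show ?thesis
    unfolding affine_equilibrium_iff[OF assms]
    using optimal_weight_nonneg[of 0 \<alpha>] w m by auto
qed

text \<open>Optimality of the decoder does not involve \<open>\<theta>\<close>, so for \<open>\<theta> = 0\<close> it can be read off from the
equilibrium for \<open>\<theta> = 1\<close>.\<close>

lemma uninformative_equilibrium:
  assumes "0 \<le> \<theta>"
  shows "(0, 0, \<sigma>x\<^sup>2 / (\<sigma>x\<^sup>2 + \<sigma>w\<^sup>2), 0, 0) \<in> affine_equilibria M x v w \<theta> b"
proof (cases "\<theta> = 0")
  case False
  then show ?thesis using assms equilibrium_zero_iff by simp
next
  case True
  have "optimal_decoder M x v w (affine_fun 0 0) 0 (affine_fun (\<sigma>x\<^sup>2 / (\<sigma>x\<^sup>2 + \<sigma>w\<^sup>2)) 0)"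
    using equilibrium_zero_iff[of 1 0 "\<sigma>x\<^sup>2 / (\<sigma>x\<^sup>2 + \<sigma>w\<^sup>2)" 0 0]
    by (simp add: affine_equilibria_def nash_equilibrium_def)
  then show ?thesis
    using True optimal_encoder_indifferent[of 0 _ "affine_fun 0 0"] measurable_affine_fun
    by (simp add: affine_equilibria_def nash_equilibrium_def)
qed

end

section \<open>Solving for the informative equilibria\<close>

lemma square_eq_sqrt_iff:
  fixes a t :: real
  assumes "0 \<le> t"
  shows "0 < a \<Longrightarrow> a\<^sup>2 = t \<longleftrightarrow> a = sqrt t" and "a < 0 \<Longrightarrow> a\<^sup>2 = t \<longleftrightarrow> a = - sqrt t"
proof -
  show "a\<^sup>2 = t \<longleftrightarrow> a = sqrt t" if "0 < a"
    using that assms by (auto simp: real_sqrt_unique)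
  show "a\<^sup>2 = t \<longleftrightarrow> a = - sqrt t" if "a < 0"
    using that assms real_sqrt_unique[of "- a" t] by auto
qed

text \<open>All radicals occurring in the equilibria are expressed through the single quantity \<open>T\<close>.\<close>

lemma sqrt_inverse_identities:
  fixes \<sigma>x \<sigma>v \<theta> :: real
  assumes "0 < \<sigma>x" "0 < \<sigma>v" "0 < \<theta>"
  defines "T \<equiv> sqrt (1 / \<theta> * (\<sigma>v\<^sup>2 / \<sigma>x\<^sup>2))"
  shows "0 < T" and "T\<^sup>2 = \<sigma>v\<^sup>2 / (\<theta> * \<sigma>x\<^sup>2)" and "\<theta> * T\<^sup>2 * \<sigma>x\<^sup>2 = \<sigma>v\<^sup>2"
    and "sqrt (\<sigma>v\<^sup>2 / (\<theta> * \<sigma>x\<^sup>2)) = T"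
    and "sqrt (\<theta> * (\<sigma>x\<^sup>2 / \<sigma>v\<^sup>2)) = 1 / T" and "sqrt (\<theta> * \<sigma>x\<^sup>2 / \<sigma>v\<^sup>2) = 1 / T"
proof -
  show T: "0 < T" and T2: "T\<^sup>2 = \<sigma>v\<^sup>2 / (\<theta> * \<sigma>x\<^sup>2)"
    unfolding T_def using assms(1-3) by simp_all
  show "\<theta> * T\<^sup>2 * \<sigma>x\<^sup>2 = \<sigma>v\<^sup>2" unfolding T2 using assms(1-3) by simp
  show "sqrt (\<sigma>v\<^sup>2 / (\<theta> * \<sigma>x\<^sup>2)) = T" unfolding T_def by simp
  have "\<theta> * \<sigma>x\<^sup>2 / \<sigma>v\<^sup>2 = (1 / T)\<^sup>2"
    unfolding power_divide T2 using assms(1-3) by simp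
  with T show "sqrt (\<theta> * \<sigma>x\<^sup>2 / \<sigma>v\<^sup>2) = 1 / T" by simp
  then show "sqrt (\<theta> * (\<sigma>x\<^sup>2 / \<sigma>v\<^sup>2)) = 1 / T" by simp
qed

context gaussian_sources
begin

text \<open>In terms of \<open>T = \<surd>(\<sigma>v\<^sup>2 / (\<theta> \<sigma>x\<^sup>2))\<close> the equations for the two denominators are linear after
taking positive square roots, so each determines \<open>A\<^sup>2\<close>. The bound on \<open>\<theta>\<close> enters as \<open>large\<close>, which is its
square root up to positive factors.\<close>

lemma informative_equilibria:
  assumes theta: "0 < \<theta>" "\<theta> < (\<sigma>x\<^sup>2 / \<sigma>v\<^sup>2) / (\<sigma>x\<^sup>2 / \<sigma>w\<^sup>2 + 1)\<^sup>2"
  defines "T \<equiv> sqrt (1 / \<theta> * (\<sigma>v\<^sup>2 / \<sigma>x\<^sup>2))"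
  defines "Ap \<equiv> sqrt (T - \<sigma>v\<^sup>2 / \<sigma>w\<^sup>2 - \<sigma>v\<^sup>2 / \<sigma>x\<^sup>2)"
    and "An \<equiv> - sqrt (T - \<sigma>v\<^sup>2 / \<sigma>x\<^sup>2)"
    and "Kn \<equiv> - sqrt (1 / T - \<theta>)"
  defines "Kp \<equiv> 1 / T * ((Ap * \<sigma>x\<^sup>2 * \<sigma>w\<^sup>2 + \<sigma>x\<^sup>2 * \<sigma>v\<^sup>2) / (\<sigma>x\<^sup>2 * \<sigma>w\<^sup>2))"
  shows "0 < Ap" and "An < 0"
    and "0 < A \<Longrightarrow> (A, C, K, L, \<alpha>) \<in> affine_equilibria M x v w \<theta> b \<longleftrightarrow>
      A = Ap \<and> \<alpha> = matched_weight Ap \<and> K = Kp \<and> C = - (\<alpha> * K * b / \<theta>) \<and> L = \<alpha>\<^sup>2 * K\<^sup>2 * b / \<theta>"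
    and "A < 0 \<Longrightarrow> (A, C, K, L, \<alpha>) \<in> affine_equilibria M x v w \<theta> b \<longleftrightarrow>
      A = An \<and> \<alpha> = 1 \<and> K = Kn \<and> C = - (K * b / \<theta>) \<and> L = (1 / T - \<theta>) * b / \<theta>"
proof -
  note T = sqrt_inverse_identities[OF std_dev_pos(1,2) theta(1), folded T_def]
  \<comment> \<open>The hypothesis on \<open>\<theta>\<close>, multiplied by \<open>\<sigma>v\<^sup>4 / (\<theta> \<sigma>x\<^sup>4)\<close>, is the square of this inequality.\<close>
  have large: "\<sigma>v\<^sup>2 / \<sigma>w\<^sup>2 + \<sigma>v\<^sup>2 / \<sigma>x\<^sup>2 < T"
  proof (rule power2_less_imp_less)
    have p: "0 < (\<sigma>x\<^sup>2 / \<sigma>w\<^sup>2 + 1)\<^sup>2" by (intro zero_less_power add_nonneg_pos) simp_all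
    have "\<theta> * (\<sigma>x\<^sup>2 / \<sigma>w\<^sup>2 + 1)\<^sup>2 < \<sigma>x\<^sup>2 / \<sigma>v\<^sup>2"
      using theta(2) unfolding pos_less_divide_eq[OF p] .
    then have "\<theta> * (\<sigma>x\<^sup>2 / \<sigma>w\<^sup>2 + 1)\<^sup>2 * ((\<sigma>v\<^sup>2)\<^sup>2 / (\<theta> * (\<sigma>x\<^sup>2)\<^sup>2)) <
        \<sigma>x\<^sup>2 / \<sigma>v\<^sup>2 * ((\<sigma>v\<^sup>2)\<^sup>2 / (\<theta> * (\<sigma>x\<^sup>2)\<^sup>2))"
      using theta(1) std_dev_pos by (intro mult_strict_right_mono) simp_all
    moreover have "\<sigma>x\<^sup>2 / \<sigma>v\<^sup>2 * ((\<sigma>v\<^sup>2)\<^sup>2 / (\<theta> * (\<sigma>x\<^sup>2)\<^sup>2)) = T\<^sup>2"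
      unfolding T(2) using theta(1) std_dev_pos by (simp add: field_simps power2_eq_square)
    moreover have "\<theta> * (\<sigma>x\<^sup>2 / \<sigma>w\<^sup>2 + 1)\<^sup>2 * ((\<sigma>v\<^sup>2)\<^sup>2 / (\<theta> * (\<sigma>x\<^sup>2)\<^sup>2)) =
        (\<sigma>v\<^sup>2 / \<sigma>w\<^sup>2 + \<sigma>v\<^sup>2 / \<sigma>x\<^sup>2)\<^sup>2"
    proof -
      have h: "(\<sigma>x\<^sup>2 / \<sigma>w\<^sup>2 + 1) * (\<sigma>v\<^sup>2 / \<sigma>x\<^sup>2) = \<sigma>v\<^sup>2 / \<sigma>w\<^sup>2 + \<sigma>v\<^sup>2 / \<sigma>x\<^sup>2"
        using std_dev_pos by (simp add: field_simps)
      show ?thesis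
        unfolding h[symmetric] using theta(1) by (simp only: power_mult_distrib power_divide) simp
    qed
    ultimately show "(\<sigma>v\<^sup>2 / \<sigma>w\<^sup>2 + \<sigma>v\<^sup>2 / \<sigma>x\<^sup>2)\<^sup>2 < T\<^sup>2" by simp
  qed (use T(1) in simp)
  have vw: "0 < \<sigma>v\<^sup>2 / \<sigma>w\<^sup>2" using std_dev_pos by simp
  show Ap: "0 < Ap" unfolding Ap_def using large by simp
  show "An < 0" unfolding An_def using large vw by simp
  show "(A, C, K, L, \<alpha>) \<in> affine_equilibria M x v w \<theta> b \<longleftrightarrow>
      A = Ap \<and> \<alpha> = matched_weight Ap \<and> K = Kp \<and> C = - (\<alpha> * K * b / \<theta>) \<and> L = \<alpha>\<^sup>2 * K\<^sup>2 * b / \<theta>"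
    if "0 < A"
  proof -
    let ?E = "\<lambda>A. \<sigma>x\<^sup>2 * (A\<^sup>2 * \<sigma>w\<^sup>2 + \<sigma>v\<^sup>2) + \<sigma>v\<^sup>2 * \<sigma>w\<^sup>2"
    have E: "?E A = \<sigma>w\<^sup>2 * \<sigma>x\<^sup>2 * T \<longleftrightarrow> A = Ap"
    proof -
      have "?E A = \<sigma>w\<^sup>2 * \<sigma>x\<^sup>2 * T \<longleftrightarrow> A\<^sup>2 = T - \<sigma>v\<^sup>2 / \<sigma>w\<^sup>2 - \<sigma>v\<^sup>2 / \<sigma>x\<^sup>2"
        using std_dev_pos by (simp add: field_simps)
      then show ?thesis
        unfolding Ap_def using square_eq_sqrt_iff(1)[OF _ that] large by simp
    qed
    have "\<theta> * (?E A)\<^sup>2 = (\<sigma>w\<^sup>2)\<^sup>2 * \<sigma>x\<^sup>2 * \<sigma>v\<^sup>2 \<longleftrightarrow> (?E A)\<^sup>2 = (\<sigma>w\<^sup>2 * \<sigma>x\<^sup>2 * T)\<^sup>2"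
    proof -
      have "(\<sigma>w\<^sup>2)\<^sup>2 * \<sigma>x\<^sup>2 * \<sigma>v\<^sup>2 = \<theta> * (\<sigma>w\<^sup>2 * \<sigma>x\<^sup>2 * T)\<^sup>2"
        unfolding T(3)[symmetric] by algebra
      then show ?thesis using theta(1) by simp
    qed
    also have "\<dots> \<longleftrightarrow> ?E A = \<sigma>w\<^sup>2 * \<sigma>x\<^sup>2 * T"
      using T(1) by (intro power2_eq_iff_nonneg) simp_all
    finally have stat: "\<theta> * (?E A)\<^sup>2 = (\<sigma>w\<^sup>2)\<^sup>2 * \<sigma>x\<^sup>2 * \<sigma>v\<^sup>2 \<longleftrightarrow> A = Ap" unfolding E .
    have "(A * \<sigma>w\<^sup>2 + \<sigma>v\<^sup>2) * \<sigma>x\<^sup>2 / ?E A = Kp" if "A = Ap"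
    proof -
      have E_Ap: "?E A = \<sigma>w\<^sup>2 * \<sigma>x\<^sup>2 * T" using E that by simp
      have numerator: "(A * \<sigma>w\<^sup>2 + \<sigma>v\<^sup>2) * \<sigma>x\<^sup>2 = Ap * \<sigma>x\<^sup>2 * \<sigma>w\<^sup>2 + \<sigma>x\<^sup>2 * \<sigma>v\<^sup>2"
        by (simp add: that algebra_simps)
      show ?thesis
        unfolding E_Ap numerator Kp_def by (simp add: ac_simps)
    qed
    then show ?thesis unfolding equilibrium_pos_iff[OF theta(1) that] stat by auto
  qed
  show "(A, C, K, L, \<alpha>) \<in> affine_equilibria M x v w \<theta> b \<longleftrightarrow>
      A = An \<and> \<alpha> = 1 \<and> K = Kn \<and> C = - (K * b / \<theta>) \<and> L = (1 / T - \<theta>) * b / \<theta>"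
    if "A < 0"
  proof -
    let ?E = "A\<^sup>2 * \<sigma>x\<^sup>2 + \<sigma>v\<^sup>2"
    have E: "?E = \<sigma>x\<^sup>2 * T \<longleftrightarrow> A\<^sup>2 = T - \<sigma>v\<^sup>2 / \<sigma>x\<^sup>2"
      using std_dev_pos by (simp add: field_simps)
    have An: "A\<^sup>2 = T - \<sigma>v\<^sup>2 / \<sigma>x\<^sup>2 \<longleftrightarrow> A = An"
      unfolding An_def using square_eq_sqrt_iff(2)[OF _ that] large vw by simp
    have "\<theta> * ?E\<^sup>2 = \<sigma>x\<^sup>2 * \<sigma>v\<^sup>2 \<longleftrightarrow> ?E\<^sup>2 = (\<sigma>x\<^sup>2 * T)\<^sup>2"
    proof -
      have "\<sigma>x\<^sup>2 * \<sigma>v\<^sup>2 = \<theta> * (\<sigma>x\<^sup>2 * T)\<^sup>2"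
        unfolding T(3)[symmetric] by algebra
      then show ?thesis using theta(1) by simp
    qed
    also have "\<dots> \<longleftrightarrow> ?E = \<sigma>x\<^sup>2 * T"
      using T(1) by (intro power2_eq_iff_nonneg) simp_all
    finally have stat: "\<theta> * ?E\<^sup>2 = \<sigma>x\<^sup>2 * \<sigma>v\<^sup>2 \<longleftrightarrow> A = An" unfolding E An .
    have at: "1 / \<sigma>w\<^sup>2 \<le> A\<^sup>2 / \<sigma>v\<^sup>2" "A * \<sigma>x\<^sup>2 / ?E = Kn" "Kn\<^sup>2 = 1 / T - \<theta>" if eq: "A = An"
    proof -
      have A2: "A\<^sup>2 = T - \<sigma>v\<^sup>2 / \<sigma>x\<^sup>2" using An eq by simp
      have "\<sigma>v\<^sup>2 / \<sigma>w\<^sup>2 \<le> A\<^sup>2" unfolding A2 using large by simp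
      then show "1 / \<sigma>w\<^sup>2 \<le> A\<^sup>2 / \<sigma>v\<^sup>2"
        using std_dev_pos by (simp add: pos_le_divide_eq)
      have K: "A * \<sigma>x\<^sup>2 / ?E = A / T"
        unfolding E[THEN iffD2, OF A2] using std_dev_pos by simp
      have "(A / T)\<^sup>2 = 1 / T - \<theta>"
      proof -
        have "\<sigma>v\<^sup>2 / \<sigma>x\<^sup>2 = \<theta> * T\<^sup>2" unfolding T(2) using theta(1) by simp
        then have "A\<^sup>2 = T - \<theta> * T\<^sup>2" using A2 by simp
        then show ?thesis using T(1)
          by (simp add: power_divide diff_divide_distrib) (simp add: power2_eq_square)
      qed
      moreover from this have "0 \<le> 1 / T - \<theta>" by (metis zero_le_power2)
      moreover have "A / T < 0" using \<open>A < 0\<close> T(1) by (simp add: divide_neg_pos)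
      ultimately show "A * \<sigma>x\<^sup>2 / ?E = Kn" and "Kn\<^sup>2 = 1 / T - \<theta>"
        unfolding K Kn_def using square_eq_sqrt_iff(2) by simp_all
    qed
    then show ?thesis unfolding equilibrium_neg_iff[OF theta(1) that] stat by auto
  qed
qed

lemma optimal_decoder_affine:
  "(\<exists>\<alpha> K L. optimal_decoder M x v w (affine_fun A C) \<alpha> (affine_fun K L)) \<and>
   (\<forall>\<alpha> dec. optimal_decoder M x v w (affine_fun A C) \<alpha> dec \<longrightarrow>
      (\<exists>K L. AE \<omega> in M. dec (received x v w (affine_fun A C) \<alpha> \<omega>) =
                         affine_fun K L (received x v w (affine_fun A C) \<alpha> \<omega>)))"
  using optimal_weight_exists[of A]
  by (auto simp: optimal_affine_decoder_iff) (auto simp: optimal_decoder_iff bayes_decoder_def)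

lemma optimal_encoder_affine:
  assumes "0 \<le> \<theta>"
  shows "(\<exists>A C. optimal_encoder M x v w \<theta> b \<alpha> (affine_fun K L) (affine_fun A C)) \<and>
    (\<theta> \<noteq> 0 \<or> \<alpha> * K \<noteq> 0 \<longrightarrow>
      (\<forall>enc. optimal_encoder M x v w \<theta> b \<alpha> (affine_fun K L) enc \<longrightarrow>
        (\<exists>A C. AE \<omega> in M. enc (x \<omega>) = affine_fun A C (x \<omega>))))"
proof (cases "\<theta> \<noteq> 0 \<or> \<alpha> * K \<noteq> 0")
  case True
  then have pos: "0 < (\<alpha> * K)\<^sup>2 + \<theta>"
    using assms by (metis add_nonneg_pos add_pos_nonneg less_le zero_le_power2 zero_less_power2)
  have "optimal_encoder M x v w \<theta> b \<alpha> (affine_fun K L) (best_encoder \<theta> b \<alpha> K L)"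
    unfolding optimal_encoder_iff[OF assms pos] by (simp add: measurable_best_encoder)
  then show ?thesis
    unfolding optimal_encoder_iff[OF assms pos] unfolding best_encoder_def by blast
next
  case False
  then show ?thesis
    using optimal_encoder_indifferent[of \<alpha> K "affine_fun 0 0"] measurable_affine_fun by auto
qed

end

theorem theoremV1:
  fixes M :: "'a measure" and x v w :: "'a \<Rightarrow> real"
    and \<sigma>x \<sigma>v \<sigma>w \<theta> b :: real
  assumes sources: "gaussian_sources M x v w \<sigma>x \<sigma>v \<sigma>w"
    and theta_nonneg: "0 \<le> \<theta>"
  shows
    "(\<forall>A C.
        (\<exists>\<alpha> K L. optimal_decoder M x v w (affine_fun A C) \<alpha> (affine_fun K L)) \<and>
        (\<forall>\<alpha> dec. optimal_decoder M x v w (affine_fun A C) \<alpha> dec \<longrightarrow>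
           (\<exists>K L. AE \<omega> in M. dec (received x v w (affine_fun A C) \<alpha> \<omega>) =
                              affine_fun K L (received x v w (affine_fun A C) \<alpha> \<omega>))))
     \<and> (\<forall>\<alpha>\<in>{0..1}. \<forall>K L.
        (\<exists>A C. optimal_encoder M x v w \<theta> b \<alpha> (affine_fun K L) (affine_fun A C)) \<and>
        (\<theta> \<noteq> 0 \<or> \<alpha> * K \<noteq> 0 \<longrightarrow>
           (\<forall>enc. optimal_encoder M x v w \<theta> b \<alpha> (affine_fun K L) enc \<longrightarrow>
              (\<exists>A C. AE \<omega> in M. enc (x \<omega>) = affine_fun A C (x \<omega>)))))
     \<and> (0 < \<theta> \<and> \<theta> < (\<sigma>x\<^sup>2 / \<sigma>v\<^sup>2) / (\<sigma>x\<^sup>2 / \<sigma>w\<^sup>2 + 1)\<^sup>2 \<longrightarrow>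
        (let As = sqrt (sqrt (1 / \<theta> * (\<sigma>v\<^sup>2 / \<sigma>x\<^sup>2)) - \<sigma>v\<^sup>2 / \<sigma>w\<^sup>2 - \<sigma>v\<^sup>2 / \<sigma>x\<^sup>2);
             \<alpha>a = As * \<sigma>w\<^sup>2 / (As * \<sigma>w\<^sup>2 + \<sigma>v\<^sup>2);
             Ka = sqrt (\<theta> * (\<sigma>x\<^sup>2 / \<sigma>v\<^sup>2)) *
                  ((As * \<sigma>x\<^sup>2 * \<sigma>w\<^sup>2 + \<sigma>x\<^sup>2 * \<sigma>v\<^sup>2) / (\<sigma>x\<^sup>2 * \<sigma>w\<^sup>2));
             eq_a = (As, - (\<alpha>a * Ka * b / \<theta>), Ka, \<alpha>a\<^sup>2 * Ka\<^sup>2 * b / \<theta>, \<alpha>a);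
             eq_b = (- sqrt (sqrt (\<sigma>v\<^sup>2 / (\<theta> * \<sigma>x\<^sup>2)) - \<sigma>v\<^sup>2 / \<sigma>x\<^sup>2),
                     b / \<theta> * sqrt (sqrt (\<theta> * \<sigma>x\<^sup>2 / \<sigma>v\<^sup>2) - \<theta>),
                     - sqrt (sqrt (\<theta> * \<sigma>x\<^sup>2 / \<sigma>v\<^sup>2) - \<theta>),
                     b / \<theta> * (sqrt (\<theta> * \<sigma>x\<^sup>2 / \<sigma>v\<^sup>2) - \<theta>),
                     1)
         in eq_a \<noteq> eq_b \<and>
            affine_equilibria M x v w \<theta> b - {(0, 0, \<sigma>x\<^sup>2 / (\<sigma>x\<^sup>2 + \<sigma>w\<^sup>2), 0, 0)} = {eq_a, eq_b}))
     \<and> (0, 0, \<sigma>x\<^sup>2 / (\<sigma>x\<^sup>2 + \<sigma>w\<^sup>2), 0, 0) \<in> affine_equilibria M x v w \<theta> b"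
proof -
  interpret gaussian_sources M x v w \<sigma>x \<sigma>v \<sigma>w by (rule sources)
  note triv = uninformative_equilibrium[OF theta_nonneg, of b]
  have informative:
    "let As = sqrt (sqrt (1 / \<theta> * (\<sigma>v\<^sup>2 / \<sigma>x\<^sup>2)) - \<sigma>v\<^sup>2 / \<sigma>w\<^sup>2 - \<sigma>v\<^sup>2 / \<sigma>x\<^sup>2);
             \<alpha>a = As * \<sigma>w\<^sup>2 / (As * \<sigma>w\<^sup>2 + \<sigma>v\<^sup>2);
             Ka = sqrt (\<theta> * (\<sigma>x\<^sup>2 / \<sigma>v\<^sup>2)) *
                  ((As * \<sigma>x\<^sup>2 * \<sigma>w\<^sup>2 + \<sigma>x\<^sup>2 * \<sigma>v\<^sup>2) / (\<sigma>x\<^sup>2 * \<sigma>w\<^sup>2));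
             eq_a = (As, - (\<alpha>a * Ka * b / \<theta>), Ka, \<alpha>a\<^sup>2 * Ka\<^sup>2 * b / \<theta>, \<alpha>a);
             eq_b = (- sqrt (sqrt (\<sigma>v\<^sup>2 / (\<theta> * \<sigma>x\<^sup>2)) - \<sigma>v\<^sup>2 / \<sigma>x\<^sup>2),
                     b / \<theta> * sqrt (sqrt (\<theta> * \<sigma>x\<^sup>2 / \<sigma>v\<^sup>2) - \<theta>),
                     - sqrt (sqrt (\<theta> * \<sigma>x\<^sup>2 / \<sigma>v\<^sup>2) - \<theta>),
                     b / \<theta> * (sqrt (\<theta> * \<sigma>x\<^sup>2 / \<sigma>v\<^sup>2) - \<theta>),
                     1)
         in eq_a \<noteq> eq_b \<and>
            affine_equilibria M x v w \<theta> b - {(0, 0, \<sigma>x\<^sup>2 / (\<sigma>x\<^sup>2 + \<sigma>w\<^sup>2), 0, 0)} = {eq_a, eq_b}"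
    if theta: "0 < \<theta>" "\<theta> < (\<sigma>x\<^sup>2 / \<sigma>v\<^sup>2) / (\<sigma>x\<^sup>2 / \<sigma>w\<^sup>2 + 1)\<^sup>2"
  proof -
    define T where "T = sqrt (1 / \<theta> * (\<sigma>v\<^sup>2 / \<sigma>x\<^sup>2))"
    define Ap where "Ap = sqrt (T - \<sigma>v\<^sup>2 / \<sigma>w\<^sup>2 - \<sigma>v\<^sup>2 / \<sigma>x\<^sup>2)"
    define An where "An = - sqrt (T - \<sigma>v\<^sup>2 / \<sigma>x\<^sup>2)"
    define Kp where "Kp = 1 / T * ((Ap * \<sigma>x\<^sup>2 * \<sigma>w\<^sup>2 + \<sigma>x\<^sup>2 * \<sigma>v\<^sup>2) / (\<sigma>x\<^sup>2 * \<sigma>w\<^sup>2))"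
    define \<alpha>p where "\<alpha>p = Ap * \<sigma>w\<^sup>2 / (Ap * \<sigma>w\<^sup>2 + \<sigma>v\<^sup>2)"
    define Kn where "Kn = - sqrt (1 / T - \<theta>)"
    define eq_a where "eq_a = (Ap, - (\<alpha>p * Kp * b / \<theta>), Kp, \<alpha>p\<^sup>2 * Kp\<^sup>2 * b / \<theta>, \<alpha>p)"
    define eq_b where "eq_b = (An, b / \<theta> * sqrt (1 / T - \<theta>), Kn, b / \<theta> * (1 / T - \<theta>), 1::real)"
    note T = sqrt_inverse_identities[OF std_dev_pos(1,2) theta(1), folded T_def]
    note inf = informative_equilibria[OF theta, folded T_def, folded Ap_def An_def Kn_def,
        folded Kp_def, unfolded matched_weight_def, folded \<alpha>p_def]
    have mem: "z \<in> affine_equilibria M x v w \<theta> b - {(0, 0, \<sigma>x\<^sup>2 / (\<sigma>x\<^sup>2 + \<sigma>w\<^sup>2), 0, 0)} \<longleftrightarrow>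
        z = eq_a \<or> z = eq_b" for z
    proof -
      obtain A C K L \<alpha> where z: "z = (A, C, K, L, \<alpha>)" by (metis prod.exhaust)
      consider "A = 0" | "0 < A" | "A < 0" by linarith
      then show ?thesis
      proof cases
        case 1
        then show ?thesis
          using inf(1,2) by (auto simp: z eq_a_def eq_b_def equilibrium_zero_iff[OF theta(1)])
      next
        case 2
        then show ?thesis
          using inf(2) by (auto simp: z eq_a_def eq_b_def inf(3)[OF 2])
      next
        case 3
        then show ?thesis
          using inf(1) by (auto simp: z eq_a_def eq_b_def Kn_def inf(4)[OF 3])
      qed
    qed
    have "eq_a \<noteq> eq_b" using inf(1,2) by (simp add: eq_a_def eq_b_def)
    moreover have "affine_equilibria M x v w \<theta> b - {(0, 0, \<sigma>x\<^sup>2 / (\<sigma>x\<^sup>2 + \<sigma>w\<^sup>2), 0, 0)} = {eq_a, eq_b}"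
      using mem by blast
    ultimately show ?thesis
      unfolding Let_def T(4,5,6) T_def[symmetric] Ap_def[symmetric] An_def[symmetric] Kn_def[symmetric]
        Kp_def[symmetric] \<alpha>p_def[symmetric] eq_a_def[symmetric] eq_b_def[symmetric] by simp
  qed
  show ?thesis
  proof (intro conjI)
    show "\<forall>A C. (\<exists>\<alpha> K L. optimal_decoder M x v w (affine_fun A C) \<alpha> (affine_fun K L)) \<and>
        (\<forall>\<alpha> dec. optimal_decoder M x v w (affine_fun A C) \<alpha> dec \<longrightarrow>
           (\<exists>K L. AE \<omega> in M. dec (received x v w (affine_fun A C) \<alpha> \<omega>) =
                              affine_fun K L (received x v w (affine_fun A C) \<alpha> \<omega>)))"
      using optimal_decoder_affine by (intro allI)
    show "\<forall>\<alpha>\<in>{0..1}. \<forall>K L.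
        (\<exists>A C. optimal_encoder M x v w \<theta> b \<alpha> (affine_fun K L) (affine_fun A C)) \<and>
        (\<theta> \<noteq> 0 \<or> \<alpha> * K \<noteq> 0 \<longrightarrow>
           (\<forall>enc. optimal_encoder M x v w \<theta> b \<alpha> (affine_fun K L) enc \<longrightarrow>
              (\<exists>A C. AE \<omega> in M. enc (x \<omega>) = affine_fun A C (x \<omega>))))"
      using optimal_encoder_affine[OF theta_nonneg] by (intro ballI allI)
  qed (use informative triv in blast)+
qed

end
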